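(* Let $p\geqslant1$, $\mu,\nu\in P_p(\mathbb{R}^d)$, and let $c(x,y)=h(x-y)$ be a cost satisfying the standing assumption (see context) with this $p$. Write $S=(\mathcal{A}\cap C_{b,p})\times(\mathcal{A}\cap L^1(d\nu))$. (i) There exists an optimal dual potential pair $(Q_c(\varphi),\varphi)\in S$ for $D_c(\mu,P_{\leqslant\nu})$ such that $\varphi(y)=Q_{\bar c}(Q_c(\varphi))(y)$ for $\nu$-a.e. $y$. (ii) There exists an optimal dual potential pair $(\psi,Q_{\bar c}(\psi))\in S$ for $D_c(P_{\mu\leqslant},\nu)$ such that $\psi(x)=Q_c(Q_{\bar c}(\psi))(x)$ for $\mu$-a.e. $x$. In particular, one may always modify the dual potential pair $(\psi,\varphi)\in S$ in such a way that it is optimal for both the backward and the forward dual, and $$\varphi=Q_{\bar c}(\psi),\qquad \psi=Q_c(\varphi)$$ hold everywhere on $\mathbb{R}^d$.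
   Context: $P_p(\mathbb{R}^d)$ is the set of Borel probability measures on $\mathbb{R}^d$ with finite $p$-th moment. $\mathcal{A}$ is the set of real-valued convex functions on $\mathbb{R}^d$. $C_{b,p}$ is the set of continuous $f:\mathbb{R}^d\to\mathbb{R}$ such that $f(x)/(1+|x|^p)$ is bounded. $P_{\leqslant\nu}$, $P_{\mu\leqslant}$ denote the sets of measures in $P_1(\mathbb{R}^d)$ that are respectively dominated by $\nu$ and dominating $\mu$ in the convex order (i.e. tested against all functions of $\mathcal{A}$). Standing assumption on the cost: $c(x,y)=h(x-y)$ with $h:\mathbb{R}^d\to[0,\infty)$ strictly convex such that for some $a>0$, $\inf_{|z|\geqslant a}h(z)/|z|>0$ and $\sup_{|z|\geqslant a}h(z)/|z|^p<\infty$. Transforms: $Q_c(\varphi)(x)=\inf_{y}\{\varphi(y)+c(x,y)\}$, $Q_{\bar c}(\psi)(y)=\sup_{x}\{\psi(x)-c(x,y)\}$. Dual problems: $D_c(\mu,P_{\leqslant\nu})=\sup_{\varphi\in\mathcal{A}\cap C_{b,p}}\{\int Q_c(\varphi)d\mu-\int\varphi\,d\nu\}$ (backward; the class may be relaxed to $\mathcal{A}\cap L^1(d\nu)$ without changing the supremum) and $D_c(P_{\mu\leqslant},\nu)=\sup_{\psi\in\mathcal{A}\cap C_{b,p}}\{\int\psi\,d\mu-\int Q_{\bar c}(\psi)d\nu\}$ (forward). If $\varphi\in\mathcal{A}\cap L^1(d\nu)$ attains the backward supremum, $(Q_c(\varphi),\varphi)$ is called an optimal dual potential pair for $D_c(\mu,P_{\leqslant\nu})$;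 if $\psi\in\mathcal{A}\cap C_{b,p}$ attains the forward supremum, $(\psi,Q_{\bar c}(\psi))$ is called an optimal dual potential pair for $D_c(P_{\mu\leqslant},\nu)$.
   Formalization: In the slot 𝒜∩L¹(dν), φ may take the value +∞ off a ν-null set; with real-valued φ the claim is false (d=1, h(z)=z², μ standard normal, ν uniform on [−1,1]). "Modify" is read as changing an optimal pair on null sets. *)

theory Defs
  imports "HOL-Probability.Probability"
begin

definition P_moment :: "real \<Rightarrow> 'a::euclidean_space measure set" where
  "P_moment p =
     {M. prob_space M \<and> sets M = sets borel \<and> integrable M (\<lambda>x. norm x powr p)}"

definition convex_functions :: "('a::euclidean_space \<Rightarrow> real) set" where
  "convex_functions = {f. convex_on UNIV f}"

definition C_b :: "real \<Rightarrow> ('a::euclidean_space \<Rightarrow> real) set" where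
  "C_b p = {f. continuous_on UNIV f \<and> bounded (range (\<lambda>x. f x / (1 + norm x powr p)))}"

(* Convex functions with values in (-\<infinity>, \<infinity>] that lie in L^1(\<nu>), hence are finite \<nu>-a.e.
   The value \<infinity> has to be admitted: the transform sup_x (\<psi> x - c x y) of a real-valued \<psi> need
   not be finite off a \<nu>-null set, and with real-valued \<phi> the dual supremum can fail to be
   attained (e.g. h z = z^2 on the line, \<mu> standard normal, \<nu> uniform on [-1,1]). *)
definition convex_L1 :: "'a::euclidean_space measure \<Rightarrow> ('a \<Rightarrow> ereal) set" where
  "convex_L1 \<nu> =
     {\<phi>. (\<forall>y. \<phi> y \<noteq> - \<infinity>) \<and>
         (\<forall>x y. \<forall>t::real. 0 < t \<longrightarrow> t < 1 \<longrightarrow>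
            \<phi> ((1 - t) *\<^sub>R x + t *\<^sub>R y) \<le> ereal (1 - t) * \<phi> x + ereal t * \<phi> y) \<and>
         \<phi> \<in> borel_measurable \<nu> \<and> (\<integral>\<^sup>+ y. e2ennreal \<bar>\<phi> y\<bar> \<partial>\<nu>) < \<infinity>}"

definition strictly_convex :: "('a::real_vector \<Rightarrow> real) \<Rightarrow> bool" where
  "strictly_convex h \<longleftrightarrow>
     (\<forall>x y. \<forall>t::real. x \<noteq> y \<longrightarrow> 0 < t \<longrightarrow> t < 1 \<longrightarrow>
        h ((1 - t) *\<^sub>R x + t *\<^sub>R y) < (1 - t) * h x + t * h y)"

definition standing_cost :: "real \<Rightarrow> ('a::euclidean_space \<Rightarrow> real) \<Rightarrow> bool" where
  "standing_cost p h \<longleftrightarrow>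
     (\<forall>z. 0 \<le> h z) \<and> strictly_convex h \<and>
     (\<exists>a>0. (INF z\<in>{z. a \<le> norm z}. h z / norm z) > 0 \<and>
            bdd_above ((\<lambda>z. h z / norm z powr p) ` {z. a \<le> norm z}))"

definition cost :: "('a::euclidean_space \<Rightarrow> real) \<Rightarrow> 'a \<Rightarrow> 'a \<Rightarrow> real" where
  "cost h x y = h (x - y)"

definition Q_inf :: "('a \<Rightarrow> 'a \<Rightarrow> real) \<Rightarrow> ('a \<Rightarrow> ereal) \<Rightarrow> 'a \<Rightarrow> ereal" where
  "Q_inf c \<phi> x = (INF y. \<phi> y + ereal (c x y))"

definition Q_sup :: "('a \<Rightarrow> 'a \<Rightarrow> real) \<Rightarrow> ('a \<Rightarrow> ereal) \<Rightarrow> 'a \<Rightarrow> ereal" where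
  "Q_sup c \<psi> y = (SUP x. \<psi> x - ereal (c x y))"

(* Integral with values in [-\<infinity>, \<infinity>]: transforms of admissible potentials need not be integrable,
   but for p-th moment marginals and a cost of p-th order growth at least one of the two parts
   below is finite in every use, so that \<infinity> - \<infinity> does not occur. *)
definition ext_integral :: "'a measure \<Rightarrow> ('a \<Rightarrow> ereal) \<Rightarrow> ereal" where
  "ext_integral M f =
     enn2ereal (\<integral>\<^sup>+ x. e2ennreal (f x) \<partial>M) - enn2ereal (\<integral>\<^sup>+ x. e2ennreal (- f x) \<partial>M)"

definition backward_value ::
  "('a \<Rightarrow> 'a \<Rightarrow> real) \<Rightarrow> 'a measure \<Rightarrow> 'a measure \<Rightarrow> ('a \<Rightarrow> ereal) \<Rightarrow> ereal" where
  "backward_value c \<mu> \<nu> \<phi> = ext_integral \<mu> (Q_inf c \<phi>) - ext_integral \<nu> \<phi>"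

definition forward_value ::
  "('a \<Rightarrow> 'a \<Rightarrow> real) \<Rightarrow> 'a measure \<Rightarrow> 'a measure \<Rightarrow> ('a \<Rightarrow> ereal) \<Rightarrow> ereal" where
  "forward_value c \<mu> \<nu> \<psi> = ext_integral \<mu> \<psi> - ext_integral \<nu> (Q_sup c \<psi>)"

definition D_backward ::
  "real \<Rightarrow> ('a::euclidean_space \<Rightarrow> 'a \<Rightarrow> real) \<Rightarrow> 'a measure \<Rightarrow> 'a measure \<Rightarrow> ereal" where
  "D_backward p c \<mu> \<nu> =
     (SUP \<phi>\<in>convex_functions \<inter> C_b p. backward_value c \<mu> \<nu> (\<lambda>y. ereal (\<phi> y)))"

definition D_forward ::
  "real \<Rightarrow> ('a::euclidean_space \<Rightarrow> 'a \<Rightarrow> real) \<Rightarrow> 'a measure \<Rightarrow> 'a measure \<Rightarrow> ereal" where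
  "D_forward p c \<mu> \<nu> =
     (SUP \<psi>\<in>convex_functions \<inter> C_b p. forward_value c \<mu> \<nu> (\<lambda>x. ereal (\<psi> x)))"

definition S_class ::
  "real \<Rightarrow> 'a::euclidean_space measure \<Rightarrow> (('a \<Rightarrow> real) \<times> ('a \<Rightarrow> ereal)) set" where
  "S_class p \<nu> = (convex_functions \<inter> C_b p) \<times> convex_L1 \<nu>"

definition optimal_backward_pair ::
  "real \<Rightarrow> ('a::euclidean_space \<Rightarrow> 'a \<Rightarrow> real) \<Rightarrow> 'a measure \<Rightarrow> 'a measure \<Rightarrow>
     ('a \<Rightarrow> real) \<Rightarrow> ('a \<Rightarrow> ereal) \<Rightarrow> bool" where
  "optimal_backward_pair p c \<mu> \<nu> \<psi> \<phi> \<longleftrightarrow>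
     \<phi> \<in> convex_L1 \<nu> \<and> backward_value c \<mu> \<nu> \<phi> = D_backward p c \<mu> \<nu> \<and>
     (\<forall>x. ereal (\<psi> x) = Q_inf c \<phi> x)"

definition optimal_forward_pair ::
  "real \<Rightarrow> ('a::euclidean_space \<Rightarrow> 'a \<Rightarrow> real) \<Rightarrow> 'a measure \<Rightarrow> 'a measure \<Rightarrow>
     ('a \<Rightarrow> real) \<Rightarrow> ('a \<Rightarrow> ereal) \<Rightarrow> bool" where
  "optimal_forward_pair p c \<mu> \<nu> \<psi> \<phi> \<longleftrightarrow>
     \<psi> \<in> convex_functions \<inter> C_b p \<and>
     forward_value c \<mu> \<nu> (\<lambda>x. ereal (\<psi> x)) = D_forward p c \<mu> \<nu> \<and>
     (\<forall>y. \<phi> y = Q_sup c (\<lambda>x. ereal (\<psi> x)) y)"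

end

theory Submission
  imports Defs "HOL-Complex_Analysis.Great_Picard"
begin

text \<open>
  Both transforms preserve convexity, and replacing \<open>\<psi>\<close> by \<open>Q_inf c (Q_sup c \<psi>)\<close>, or \<open>\<phi>\<close> by
  \<open>Q_sup c (Q_inf c \<phi>)\<close>, never decreases a dual value. Hence the backward and the forward supremum
  agree, and an optimal potential coincides almost everywhere with its biconjugate.

  For existence, take a backward maximizing sequence \<open>f n\<close>, normalised to vanish at the barycentre of
  \<open>\<nu>\<close>, and let \<open>g n\<close> be its infimal transforms. Jensen's inequality and the optimality bound the
  convex functions \<open>g n\<close> locally from both sides, so a subsequence converges on a countable dense
  set. Its upper limit \<open>\<psi>\<close> is convex, and since \<open>Q_sup c \<psi>\<close> is already determined by the dense set,
  it lies below the lower limit of \<open>f n\<close>; Fatou's lemma on both sides shows that \<open>\<psi>\<close> is optimal.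
\<close>

text \<open>Compactness is extracted from the \<open>g n\<close> alone. The \<open>f n\<close> have
  no common upper bound and may tend to infinity where \<nu> carries no mass, so they only serve as
  upper barriers for the potential recovered as \<open>Q_sup c \<psi>\<close>, which may itself take
  the value \<infinity>. The barycentre \<open>b\<close> serves two ends: the constraint at that
  point gives \<open>g n x\<close> \<le> \<open>h (x - b)\<close>, and the nonnegative integrals of
  the \<open>f n\<close> keep the integrals of the \<open>g n\<close> from drifting to minus
  infinity. The upper limit is used because it inherits convexity. Alone it would not suffice: a
  large value of \<open>g n\<close> along some indices raises \<open>f n\<close> only along those
  indices. True limits on a dense set make the lower bounds on \<open>f n\<close> hold for all late
  indices. Comparing the two suprema meets one obstacle: passing from a forward to a backward
  potential leaves the real-valued functions, so potentials in \<open>convex_L1\<close> have to be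
  approximated from below by admissible ones of linear growth.\<close>

text \<open>A hyperplane separating the origin from the strict epigraph, translated so that
  \<open>(x, f x)\<close> becomes the origin, is the graph of the supporting affine function once it
  is known not to be vertical.\<close>

lemma convex_on_subgradient:
  fixes f :: "'a::euclidean_space \<Rightarrow> real"
  assumes "convex_on UNIV f"
  obtains g where "\<And>y. f x + g \<bullet> (y - x) \<le> f y"
proof -
  define S where "S = {(y - x, t - f x) | y t. f y < t}"
  have "convex S"
  proof (rule convexI)
    fix a b :: "'a \<times> real" and u v :: real
    assume "a \<in> S" "b \<in> S" and uv: "0 \<le> u" "0 \<le> v" "u + v = 1"
    then obtain y1 t1 y2 t2 where a: "a = (y1 - x, t1 - f x)" "f y1 < t1"
      and b: "b = (y2 - x, t2 - f x)" "f y2 < t2"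
      by (auto simp: S_def)
    have "f (u *\<^sub>R y1 + v *\<^sub>R y2) \<le> u * f y1 + v * f y2"
      using assms uv by (auto simp: convex_on_def)
    also have "\<dots> < u * t1 + v * t2"
    proof (cases "u = 0")
      case False
      then have "u * f y1 < u * t1" "v * f y2 \<le> v * t2"
        using a(2) b(2) uv by (simp_all add: mult_left_mono)
      then show ?thesis by simp
    qed (use b(2) uv in simp)
    finally have "f (u *\<^sub>R y1 + v *\<^sub>R y2) < u * t1 + v * t2" .
    moreover have "u *\<^sub>R a + v *\<^sub>R b = ((u *\<^sub>R y1 + v *\<^sub>R y2) - (u + v) *\<^sub>R x, (u * t1 + v * t2) - (u + v) * f x)"
      by (simp add: a b algebra_simps)
    ultimately show "u *\<^sub>R a + v *\<^sub>R b \<in> S"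
      unfolding S_def uv(3) by (simp only: scaleR_one mult_1) blast
  qed
  moreover have "0 \<notin> S"
    by (auto simp: S_def zero_prod_def)
  ultimately obtain a where a: "a \<noteq> 0" "\<And>z. z \<in> S \<Longrightarrow> 0 \<le> a \<bullet> z"
    using separating_hyperplane_set_0[of S] by metis
  obtain g s where gs: "a = (g, s)" by (cases a)
  have *: "0 \<le> g \<bullet> (y - x) + s * (t - f x)" if "f y < t" for y t
  proof -
    have "(y - x, t - f x) \<in> S" unfolding S_def using that by blast
    then show ?thesis using a(2) by (fastforce simp: gs)
  qed
  have "s \<ge> 0" using *[of x "f x + 1"] by simp
  \<comment> \<open>A vertical hyperplane would leave some points of the domain on its wrong side,
    but \<open>f\<close> is finite everywhere; the point \<open>x - g\<close> exhibits this.\<close>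
  moreover have "s \<noteq> 0"
  proof
    assume "s = 0"
    then have "0 \<le> g \<bullet> ((x - g) - x)" using *[of "x - g" "f (x - g) + 1"] by simp
    then have "g \<bullet> g \<le> 0" by simp
    then have "g = 0" by (metis inner_gt_zero_iff not_less)
    with \<open>s = 0\<close> a(1) gs show False by (simp add: zero_prod_def)
  qed
  ultimately have s: "s > 0" by simp
  \<comment> \<open>The slack \<open>e\<close> is there because only the strict epigraph was
    separated.\<close>
  have "f x + (- g /\<^sub>R s) \<bullet> (y - x) \<le> f y" for y
  proof (rule field_le_epsilon)
    fix e :: real assume "e > 0"
    then have "0 \<le> g \<bullet> (y - x) + s * (f y + e - f x)"
      using *[of y "f y + e"] by simp
    then have "0 \<le> (g \<bullet> (y - x) + s * (f y + e - f x)) / s"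
      using s by simp
    then show "f x + (- g /\<^sub>R s) \<bullet> (y - x) \<le> f y + e"
      using s by (simp add: field_simps)
  qed
  then show ?thesis by (rule that)
qed

section \<open>Growth of order \<open>p\<close> and integrability under a finite \<open>p\<close>-th
  moment\<close>

definition weight :: "real \<Rightarrow> 'a::real_normed_vector \<Rightarrow> real" where
  "weight p x = 1 + norm x powr p"

lemma weight_ge_1: "weight p x \<ge> 1"
  by (simp add: weight_def)

lemma weight_minus [simp]: "weight p (- x) = weight p x"
  by (simp add: weight_def)

text \<open>The product form, available because both weights are at least 1, separates the
  variables: with one point fixed, the bound in the other is again a multiple of the weight. The
  factor \<open>2 powr p\<close> comes from bounding the norm of a sum by twice the larger
  norm.\<close>

lemma weight_add:
  assumes "p \<ge> 1"
  shows "weight p (x + y) \<le> 2 powr p * weight p x * weight p y"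
proof -
  define u v where "u = norm x powr p" and "v = norm y powr p"
  have nn: "u \<ge> 0" "v \<ge> 0" by (auto simp: u_def v_def)
  have 2: "(2::real) powr p \<ge> 1" using assms by (simp add: ge_one_powr_ge_zero)
  have "norm (x + y) powr p \<le> (2 * max (norm x) (norm y)) powr p"
    using assms norm_triangle_ineq[of x y] by (intro powr_mono2) auto
  also have "\<dots> = 2 powr p * max (norm x) (norm y) powr p"
    by (simp add: powr_mult)
  also have "\<dots> \<le> 2 powr p * (u + v)"
    by (intro mult_left_mono) (auto simp: max_def u_def v_def)
  finally have "norm (x + y) powr p \<le> 2 powr p * (u + v)" .
  moreover have "1 + 2 powr p * (u + v) \<le> 2 powr p * (1 + (u + v))"
    using 2 by (simp add: algebra_simps)
  moreover have "2 powr p * (1 + (u + v)) \<le> 2 powr p * ((1 + u) * (1 + v))"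
    using nn by (intro mult_left_mono) (auto simp: algebra_simps)
  ultimately have "1 + norm (x + y) powr p \<le> 2 powr p * ((1 + u) * (1 + v))" by linarith
  then show ?thesis by (simp add: weight_def u_def v_def mult.assoc)
qed

lemma norm_le_weight:
  assumes "p \<ge> 1"
  shows "norm x \<le> weight p x"
proof (cases "norm x \<le> 1")
  case False
  then have "norm x powr 1 \<le> norm x powr p" using assms by (intro powr_mono) auto
  then show ?thesis using False by (simp add: weight_def)
qed (auto simp: weight_def add_increasing2)

lemma C_b_iff:
  "f \<in> C_b p \<longleftrightarrow> continuous_on UNIV f \<and> (\<exists>C. \<forall>x. \<bar>f x\<bar> \<le> C * weight p x)"
proof -
  have "\<bar>f x / weight p x\<bar> \<le> C \<longleftrightarrow> \<bar>f x\<bar> \<le> C * weight p x" for x C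
    using weight_ge_1[of p x] by (simp add: field_simps)
  then show ?thesis
    by (auto simp: C_b_def bounded_iff weight_def[symmetric])
qed

text \<open>An upper bound is enough: the subgradient at 0 supplies an affine lower bound, whose
  linear growth is within the weight as \<open>p\<close> is at least 1, and finite convex functions
  on the whole space are continuous.\<close>

lemma convex_C_bI:
  assumes f: "convex_on UNIV f" and p: "p \<ge> 1" and C: "\<And>x. f x \<le> C * weight p x"
  shows "f \<in> convex_functions \<inter> C_b p"
proof -
  obtain g where g: "\<And>y. f 0 + g \<bullet> (y - 0) \<le> f y"
    using convex_on_subgradient[OF f] by blast
  have "\<bar>f x\<bar> \<le> (\<bar>C\<bar> + \<bar>f 0\<bar> + norm g) * weight p x" for x
  proof -
    note w = weight_ge_1[of p x]
    have "C * weight p x \<le> \<bar>C\<bar> * weight p x"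
      using w by (intro mult_right_mono) auto
    moreover have "\<bar>f 0\<bar> * 1 \<le> \<bar>f 0\<bar> * weight p x"
      using w by (intro mult_left_mono) auto
    moreover have "norm g * norm x \<le> norm g * weight p x"
      using norm_le_weight[OF p] by (intro mult_left_mono) auto
    moreover have "\<bar>g \<bullet> x\<bar> \<le> norm g * norm x"
      by (rule Cauchy_Schwarz_ineq2)
    moreover have "0 \<le> \<bar>C\<bar> * weight p x" using w by simp
    ultimately show ?thesis
      using g[of x] C[of x] by (simp add: algebra_simps)
  qed
  moreover have "continuous_on UNIV f"
    using f by (intro convex_on_continuous) auto
  ultimately show ?thesis
    using f by (auto simp: convex_functions_def C_b_iff)
qed

lemma integrable_weight:
  assumes "M \<in> P_moment p"
  shows "integrable M (weight p)"
proof -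
  interpret prob_space M using assms by (simp add: P_moment_def)
  show ?thesis using assms by (auto simp: P_moment_def weight_def[abs_def])
qed

lemma integrable_C_b:
  assumes "M \<in> P_moment p" and "f \<in> C_b p"
  shows "integrable M f"
proof -
  obtain C where C: "\<And>x. \<bar>f x\<bar> \<le> C * weight p x" and f: "continuous_on UNIV f"
    using assms by (auto simp: C_b_iff)
  have "f \<in> borel_measurable M"
    using f assms by (auto simp: P_moment_def borel_measurable_continuous_onI cong: measurable_cong_sets)
  moreover have "\<bar>f x\<bar> \<le> \<bar>C * weight p x\<bar>" for x
    using C[of x] by linarith
  ultimately show ?thesis
    using integrable_weight[OF assms(1)]
    by (intro Bochner_Integration.integrable_bound[of M "\<lambda>x. C * weight p x" f]) auto
qed

text \<open>Jensen's inequality: the supporting affine function at the barycentre integrates to its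
  value there.\<close>

lemma convex_C_b_barycentre:
  assumes M: "M \<in> P_moment p" and p: "p \<ge> 1" and f: "f \<in> convex_functions \<inter> C_b p"
  shows "f (\<integral>y. y \<partial>M) \<le> (\<integral>y. f y \<partial>M)"
proof -
  interpret prob_space M using M by (simp add: P_moment_def)
  have b: "(\<lambda>y. y) \<in> borel_measurable M"
    using M by (auto simp: P_moment_def cong: measurable_cong_sets)
  have I: "integrable M (\<lambda>y. y)"
    using integrable_weight[OF M] norm_le_weight[OF p] b
    by (intro Bochner_Integration.integrable_bound[of M "weight p" "\<lambda>y. y"])
       (auto intro!: AE_I2 order_trans[OF norm_le_weight[OF p] abs_ge_self])
  let ?b = "\<integral>y. y \<partial>M"
  obtain g where g: "\<And>y. f ?b + g \<bullet> (y - ?b) \<le> f y"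
    using convex_on_subgradient[of f ?b] f by (auto simp: convex_functions_def)
  have "(\<integral>y. f ?b + g \<bullet> (y - ?b) \<partial>M) \<le> (\<integral>y. f y \<partial>M)"
    using g I integrable_C_b[OF M] f by (intro integral_mono) auto
  also have "(\<integral>y. f ?b + g \<bullet> (y - ?b) \<partial>M) = f ?b + g \<bullet> ((\<integral>y. y \<partial>M) - ?b)"
    using I by (simp add: inner_diff_right prob_space)
  finally show ?thesis by simp
qed

section \<open>Order properties of the two transforms\<close>

lemma Q_inf_le: "Q_inf c \<phi> x \<le> \<phi> y + ereal (c x y)"
  unfolding Q_inf_def by (rule INF_lower) simp

lemma Q_sup_ge: "\<psi> x - ereal (c x y) \<le> Q_sup c \<psi> y"
  unfolding Q_sup_def by (rule SUP_upper) simp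

lemma Q_inf_mono: "(\<And>y. \<phi> y \<le> \<phi>' y) \<Longrightarrow> Q_inf c \<phi> x \<le> Q_inf c \<phi>' x"
  unfolding Q_inf_def by (intro INF_mono' add_mono) auto

lemma Q_sup_mono: "(\<And>x. \<psi> x \<le> \<psi>' x) \<Longrightarrow> Q_sup c \<psi> y \<le> Q_sup c \<psi>' y"
  unfolding Q_sup_def by (intro SUP_mono' ereal_minus_mono) auto

lemma le_Q_inf_Q_sup: "ereal (\<psi> x) \<le> Q_inf c (Q_sup c (\<lambda>x. ereal (\<psi> x))) x"
  unfolding Q_inf_def
proof (rule INF_greatest)
  fix y
  show "ereal (\<psi> x) \<le> Q_sup c (\<lambda>x. ereal (\<psi> x)) y + ereal (c x y)"
    using Q_sup_ge[of "\<lambda>x. ereal (\<psi> x)" x c y]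
    by (cases "Q_sup c (\<lambda>x. ereal (\<psi> x)) y") auto
qed

text \<open>Infinite values of \<open>\<phi>\<close> and of its transform cause no trouble, because
  the cost is real and no difference of infinities can arise.\<close>

lemma Q_sup_Q_inf_le: "Q_sup c (Q_inf c \<phi>) y \<le> \<phi> y"
  unfolding Q_sup_def
proof (rule SUP_least)
  fix x
  show "Q_inf c \<phi> x - ereal (c x y) \<le> \<phi> y"
    using Q_inf_le[of c \<phi> x y] by (cases "\<phi> y"; cases "Q_inf c \<phi> x") auto
qed

definition ereal_convex :: "('a::real_vector \<Rightarrow> ereal) \<Rightarrow> bool" where
  "ereal_convex \<phi> \<longleftrightarrow> (\<forall>y. \<phi> y \<noteq> - \<infinity>) \<and>
     (\<forall>x y. \<forall>t::real. 0 < t \<longrightarrow> t < 1 \<longrightarrow>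
        \<phi> ((1 - t) *\<^sub>R x + t *\<^sub>R y) \<le> ereal (1 - t) * \<phi> x + ereal t * \<phi> y)"

lemma convex_on_imp_ereal_convex:
  "convex_on UNIV f \<Longrightarrow> ereal_convex (\<lambda>x. ereal (f x))"
  using convex_onD[of UNIV f] by (auto simp: ereal_convex_def)

lemma ereal_add_less_real:
  assumes "a + ereal k < ereal r"  "a \<noteq> - \<infinity>"
  obtains b where "a = ereal b" "b + k < r"
  using assms by (cases a) auto

text \<open>Strict real upper bounds also cover transforms that take the value \<open>- \<infinity>\<close>.\<close>
lemma Q_inf_convex_step:
  assumes \<phi>: "ereal_convex \<phi>" and k: "convex_on UNIV k"
    and a: "Q_inf (cost k) \<phi> x1 < ereal a" and b: "Q_inf (cost k) \<phi> x2 < ereal b"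
    and t: "0 < t" "t < 1"
  shows "Q_inf (cost k) \<phi> ((1 - t) *\<^sub>R x1 + t *\<^sub>R x2) < ereal ((1 - t) * a + t * b)"
proof -
  obtain y1 y2 where "\<phi> y1 + ereal (k (x1 - y1)) < ereal a" "\<phi> y2 + ereal (k (x2 - y2)) < ereal b"
    using a b by (auto simp: Q_inf_def INF_less_iff cost_def)
  then obtain r1 r2 where r: "\<phi> y1 = ereal r1" "r1 + k (x1 - y1) < a" "\<phi> y2 = ereal r2" "r2 + k (x2 - y2) < b"
    using \<phi> unfolding ereal_convex_def by (meson ereal_add_less_real)
  let ?x = "(1 - t) *\<^sub>R x1 + t *\<^sub>R x2" and ?y = "(1 - t) *\<^sub>R y1 + t *\<^sub>R y2"
  have "\<phi> ?y \<le> ereal ((1 - t) * r1 + t * r2)"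
  proof -
    have "\<phi> ?y \<le> ereal (1 - t) * \<phi> y1 + ereal t * \<phi> y2"
      using \<phi> t unfolding ereal_convex_def by blast
    then show ?thesis by (simp add: r)
  qed
  moreover have "k (?x - ?y) \<le> (1 - t) * k (x1 - y1) + t * k (x2 - y2)"
  proof -
    have "?x - ?y = (1 - t) *\<^sub>R (x1 - y1) + t *\<^sub>R (x2 - y2)" by (simp add: algebra_simps)
    then show ?thesis using t by (simp only:) (intro convex_onD[OF k]; simp)
  qed
  ultimately have "\<phi> ?y + ereal (k (?x - ?y)) \<le> ereal (((1 - t) * r1 + t * r2) + ((1 - t) * k (x1 - y1) + t * k (x2 - y2)))"
    unfolding plus_ereal.simps(1)[symmetric, of "(1 - t) * r1 + t * r2"] by (intro add_mono) auto
  also have "\<dots> = ereal ((1 - t) * (r1 + k (x1 - y1)) + t * (r2 + k (x2 - y2)))"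
    by (simp add: algebra_simps)
  also have "\<dots> < ereal ((1 - t) * a + t * b)"
    using r t by (auto intro!: add_strict_mono mult_strict_left_mono)
  finally have "\<phi> ?y + ereal (k (?x - ?y)) < ereal ((1 - t) * a + t * b)" .
  with Q_inf_le[of "cost k" \<phi> ?x ?y] show ?thesis by (auto simp: cost_def)
qed

lemma Q_inf_convex_on:
  assumes \<phi>: "ereal_convex \<phi>" and k: "convex_on UNIV k"
    and f: "\<And>x. Q_inf (cost k) \<phi> x = ereal (f x)"
  shows "convex_on UNIV f"
proof (rule convex_onI)
  fix t x y :: "_" assume t: "0 < t" "t < (1::real)"
  show "f ((1 - t) *\<^sub>R x + t *\<^sub>R y) \<le> (1 - t) * f x + t * f y"
  proof (rule field_le_epsilon)
    fix e :: real assume "e > 0"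
    then have "Q_inf (cost k) \<phi> ((1 - t) *\<^sub>R x + t *\<^sub>R y) < ereal ((1 - t) * (f x + e) + t * (f y + e))"
      by (intro Q_inf_convex_step[OF \<phi> k] t) (auto simp: f)
    then show "f ((1 - t) *\<^sub>R x + t *\<^sub>R y) \<le> (1 - t) * f x + t * f y + e"
      by (simp add: f algebra_simps)
  qed
qed simp

text \<open>Minus infinity spreads by reflection: \<open>x\<close> is the midpoint of
  \<open>x0\<close> and \<open>2 *\<^sub>R x - x0\<close>. The transform is bounded above at the
  reflected point and arbitrarily low at \<open>x0\<close>, hence arbitrarily low at
  \<open>x\<close>.\<close>

lemma Q_inf_minus_infinity:
  fixes k :: "'a::euclidean_space \<Rightarrow> real"
  assumes \<phi>: "ereal_convex \<phi>" and k: "convex_on UNIV k"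
    and fin: "\<phi> y \<noteq> \<infinity>" and x0: "Q_inf (cost k) \<phi> x0 = - \<infinity>"
  shows "Q_inf (cost k) \<phi> x = - \<infinity>"
proof (rule ccontr)
  assume *: "Q_inf (cost k) \<phi> x \<noteq> - \<infinity>"
  have lt: "Q_inf (cost k) \<phi> z < \<infinity>" for z
    using Q_inf_le[of "cost k" \<phi> z y] fin by (cases "\<phi> y") auto
  obtain r where r: "Q_inf (cost k) \<phi> x = ereal r"
    using * lt[of x] by (cases "Q_inf (cost k) \<phi> x") auto
  define z where "z = 2 *\<^sub>R x - x0"
  obtain s where s: "Q_inf (cost k) \<phi> z < ereal s"
    using ereal_dense2[OF lt[of z]] by blast
  \<comment> \<open>The bound \<open>2 * r - s\<close> at \<open>x0\<close> is chosen so that the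
    midpoint bound equals \<open>r\<close>, the supposed value at \<open>x\<close>.\<close>
  have "Q_inf (cost k) \<phi> ((1 - 1/2) *\<^sub>R x0 + (1/2) *\<^sub>R z) < ereal ((1 - 1/2) * (2 * r - s) + (1/2) * s)"
    using s x0 by (intro Q_inf_convex_step[OF \<phi> k]) simp_all
  moreover have "(1 - 1/2) *\<^sub>R x0 + (1/2) *\<^sub>R z = x"
    by (simp add: z_def algebra_simps)
  ultimately show False using r by (simp add: algebra_simps)
qed

section \<open>Integrals of extended-valued functions\<close>

lemma convex_L1_iff:
  "\<phi> \<in> convex_L1 \<nu> \<longleftrightarrow>
     ereal_convex \<phi> \<and> \<phi> \<in> borel_measurable \<nu> \<and> (\<integral>\<^sup>+ y. e2ennreal \<bar>\<phi> y\<bar> \<partial>\<nu>) < \<infinity>"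
  by (auto simp: convex_L1_def ereal_convex_def)

lemma e2ennreal_ereal [simp]: "e2ennreal (ereal r) = ennreal r"
  by (simp add: ennreal.abs_eq e2ennreal_def)

lemma ext_integral_cong_AE:
  assumes "AE x in M. f x = g x"
  shows "ext_integral M f = ext_integral M g"
proof -
  have "(\<integral>\<^sup>+ x. e2ennreal (f x) \<partial>M) = (\<integral>\<^sup>+ x. e2ennreal (g x) \<partial>M)"
    "(\<integral>\<^sup>+ x. e2ennreal (- f x) \<partial>M) = (\<integral>\<^sup>+ x. e2ennreal (- g x) \<partial>M)"
    using assms by (auto intro!: nn_integral_cong_AE)
  then show ?thesis by (simp add: ext_integral_def)
qed

lemma ext_integral_ereal:
  assumes "integrable M f"
  shows "ext_integral M (\<lambda>x. ereal (f x)) = ereal (\<integral>x. f x \<partial>M)"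
proof -
  have "(\<integral>\<^sup>+ x. ennreal (f x) \<partial>M) < \<infinity>" "(\<integral>\<^sup>+ x. ennreal (- f x) \<partial>M) < \<infinity>"
    using assms by (auto simp: real_integrable_def less_top)
  then show ?thesis
    by (cases "\<integral>\<^sup>+ x. ennreal (f x) \<partial>M"; cases "\<integral>\<^sup>+ x. ennreal (- f x) \<partial>M")
       (auto simp: ext_integral_def real_lebesgue_integral_def[OF assms] enn2ereal_ennreal)
qed

lemma ext_integral_mono:
  assumes "\<And>x. f x \<le> g x"
  shows "ext_integral M f \<le> ext_integral M g"
  unfolding ext_integral_def
  by (intro ereal_minus_mono)
     (auto simp: less_eq_ennreal.rep_eq[symmetric] intro!: nn_integral_mono e2ennreal_mono assms)

lemma ext_integral_real_of_ereal:
  assumes m: "\<phi> \<in> borel_measurable M" and fin: "(\<integral>\<^sup>+ y. e2ennreal \<bar>\<phi> y\<bar> \<partial>M) < \<infinity>"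
  shows "integrable M (\<lambda>y. real_of_ereal (\<phi> y))"
    and "AE y in M. \<phi> y = ereal (real_of_ereal (\<phi> y))"
    and "ext_integral M \<phi> = ereal (\<integral>y. real_of_ereal (\<phi> y) \<partial>M)"
proof -
  have "ennreal (norm (real_of_ereal x)) \<le> e2ennreal \<bar>x\<bar>" for x
    by (cases x) auto
  then have "(\<integral>\<^sup>+ y. ennreal (norm (real_of_ereal (\<phi> y))) \<partial>M) \<le> (\<integral>\<^sup>+ y. e2ennreal \<bar>\<phi> y\<bar> \<partial>M)"
    by (intro nn_integral_mono) auto
  then show I: "integrable M (\<lambda>y. real_of_ereal (\<phi> y))"
    using m fin by (intro integrableI_bounded) auto
  have "AE y in M. e2ennreal \<bar>\<phi> y\<bar> \<noteq> \<infinity>"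
    using m fin by (intro nn_integral_noteq_infinite) auto
  then show AE: "AE y in M. \<phi> y = ereal (real_of_ereal (\<phi> y))"
  proof (eventually_elim)
    case (elim y)
    then show ?case by (cases "\<phi> y") auto
  qed
  show "ext_integral M \<phi> = ereal (\<integral>y. real_of_ereal (\<phi> y) \<partial>M)"
    using ext_integral_cong_AE[OF AE] ext_integral_ereal[OF I] by simp
qed

text \<open>The integrable minorant makes the integral of the negative part finite, so an infinite
  positive part would force the value \<infinity>.\<close>

lemma ext_integral_finite_imp_L1:
  assumes m: "\<phi> \<in> borel_measurable M" and g: "integrable M g" "\<And>y. ereal (g y) \<le> \<phi> y"
    and fin: "ext_integral M \<phi> \<noteq> \<infinity>"
  shows "(\<integral>\<^sup>+ y. e2ennreal \<bar>\<phi> y\<bar> \<partial>M) < \<infinity>"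
proof -
  have "(\<integral>\<^sup>+ y. e2ennreal (- \<phi> y) \<partial>M) \<le> (\<integral>\<^sup>+ y. ennreal (- g y) \<partial>M)"
  proof (rule nn_integral_mono)
    fix y
    have "- \<phi> y \<le> ereal (- g y)" using g(2)[of y] by (cases "\<phi> y") auto
    then show "e2ennreal (- \<phi> y) \<le> ennreal (- g y)" using e2ennreal_mono by fastforce
  qed
  also have "\<dots> < \<infinity>" using g(1) by (auto simp: real_integrable_def less_top)
  finally have neg: "(\<integral>\<^sup>+ y. e2ennreal (- \<phi> y) \<partial>M) < \<infinity>" .
  then have pos: "(\<integral>\<^sup>+ y. e2ennreal (\<phi> y) \<partial>M) < \<infinity>"
    using fin by (cases "\<integral>\<^sup>+ y. e2ennreal (\<phi> y) \<partial>M"; cases "\<integral>\<^sup>+ y. e2ennreal (- \<phi> y) \<partial>M")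
                 (auto simp: ext_integral_def enn2ereal_ennreal)
  have "e2ennreal \<bar>x\<bar> \<le> e2ennreal x + e2ennreal (- x)" for x
    by (cases x) (auto simp: abs_if)
  then have "(\<integral>\<^sup>+ y. e2ennreal \<bar>\<phi> y\<bar> \<partial>M) \<le> (\<integral>\<^sup>+ y. e2ennreal (\<phi> y) + e2ennreal (- \<phi> y) \<partial>M)"
    by (intro nn_integral_mono)
  also have "\<dots> = (\<integral>\<^sup>+ y. e2ennreal (\<phi> y) \<partial>M) + (\<integral>\<^sup>+ y. e2ennreal (- \<phi> y) \<partial>M)"
    using m by (intro nn_integral_add) auto
  also have "\<dots> < \<infinity>" using pos neg by simp
  finally show ?thesis .
qed

text \<open>A property that holds almost everywhere for a probability measure holds somewhere. The
  finite point later anchors upper bounds on the transforms.\<close>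

lemma convex_L1_finite_point:
  assumes "\<phi> \<in> convex_L1 M" "prob_space M"
  obtains y r where "\<phi> y = ereal r"
proof -
  interpret prob_space M by fact
  have "AE y in M. \<phi> y = ereal (real_of_ereal (\<phi> y))"
    using assms ext_integral_real_of_ereal by (auto simp: convex_L1_iff)
  then have "\<not> (AE y in M. \<phi> y \<noteq> ereal (real_of_ereal (\<phi> y)))"
    using AE_False AE_conj_iff by fastforce
  then obtain y where "\<phi> y = ereal (real_of_ereal (\<phi> y))"
    by auto
  then show ?thesis by (rule that)
qed

lemma AE_eq_of_integral_eq:
  fixes u v :: "'b \<Rightarrow> real"
  assumes "integrable M u" "integrable M v" "AE x in M. u x \<le> v x" "(\<integral>x. v x \<partial>M) \<le> (\<integral>x. u x \<partial>M)"
  shows "AE x in M. u x = v x"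
proof -
  have "(\<integral>x. v x - u x \<partial>M) = 0"
    using assms integral_mono_AE[OF assms(1-3)] by simp
  then have "AE x in M. v x - u x = 0"
    using assms by (subst (asm) integral_nonneg_eq_0_iff_AE) auto
  then show ?thesis by eventually_elim simp
qed

section \<open>Transforms for a convex cost of growth \<open>p\<close>\<close>

text \<open>The growth bound is required on the whole space, with \<open>K\<close> absorbing both
  the behaviour near the origin and that at infinity.\<close>

locale convex_cost =
  fixes h :: "'a::euclidean_space \<Rightarrow> real" and p K :: real and \<mu> \<nu> :: "'a measure"
  assumes p: "p \<ge> 1" and h_convex: "convex_on UNIV h"
    and h_nonneg: "\<And>z. 0 \<le> h z" and h_le: "\<And>z. h z \<le> K * weight p z"
    and \<mu>: "\<mu> \<in> P_moment p" and \<nu>: "\<nu> \<in> P_moment p"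
begin

abbreviation "c \<equiv> cost h"

lemma h_continuous: "continuous_on UNIV h"
  using h_convex by (intro convex_on_continuous) auto

lemma h_diff_le: "h (x - y) \<le> K * 2 powr p * weight p x * weight p y"
proof -
  have "0 \<le> K * weight p (0::'a)" using h_nonneg h_le order_trans by blast
  then have "0 \<le> K" using weight_ge_1[of p "0::'a"] by (simp add: zero_le_mult_iff)
  then have "K * weight p (x - y) \<le> K * (2 powr p * weight p x * weight p y)"
    using weight_add[OF p, of x "- y"] by (intro mult_left_mono) auto
  then show ?thesis using h_le[of "x - y"] by (simp add: algebra_simps)
qed

lemma prob_\<nu>: "prob_space \<nu>" using \<nu> by (simp add: P_moment_def)

lemma borel_measurable_\<nu>: "borel_measurable \<nu> = borel_measurable borel"
  using \<nu> by (auto simp: P_moment_def cong: measurable_cong_sets)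

lemma Q_sup_ge_minus_h0: "ereal (\<psi> y - h 0) \<le> Q_sup c (\<lambda>x. ereal (\<psi> x)) y"
  using Q_sup_ge[of "\<lambda>x. ereal (\<psi> x)" y c y] by (simp add: cost_def)

text \<open>With the displacement \<open>z = x - y\<close> as variable, the transform is the
  supremum over \<open>z\<close> of the translates \<open>\<psi> (y + z) - h z\<close>, each convex
  in \<open>y\<close>.\<close>

lemma ereal_convex_Q_sup:
  assumes "convex_on UNIV \<psi>"
  shows "ereal_convex (Q_sup c (\<lambda>x. ereal (\<psi> x)))"
proof -
  let ?\<phi> = "Q_sup c (\<lambda>x. ereal (\<psi> x))"
  have "?\<phi> y \<noteq> - \<infinity>" for y
    using Q_sup_ge_minus_h0[of \<psi> y] by auto
  moreover have "?\<phi> ((1 - t) *\<^sub>R y1 + t *\<^sub>R y2) \<le> ereal (1 - t) * ?\<phi> y1 + ereal t * ?\<phi> y2"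
    if t: "0 < t" "t < 1" for t y1 y2
    unfolding Q_sup_def[of c _ "_ + _"]
  proof (rule SUP_least)
    fix x
    define z where "z = x - ((1 - t) *\<^sub>R y1 + t *\<^sub>R y2)"
    have x: "x = (1 - t) *\<^sub>R (y1 + z) + t *\<^sub>R (y2 + z)"
      by (simp add: z_def algebra_simps)
    have "\<psi> x \<le> (1 - t) * \<psi> (y1 + z) + t * \<psi> (y2 + z)"
      unfolding x using convex_onD[OF assms, of t "y1 + z" "y2 + z"] t by simp
    then have "ereal (\<psi> x - h z) \<le> ereal (1 - t) * ereal (\<psi> (y1 + z) - h z) + ereal t * ereal (\<psi> (y2 + z) - h z)"
      by (simp add: algebra_simps)
    also have "\<dots> \<le> ereal (1 - t) * ?\<phi> y1 + ereal t * ?\<phi> y2"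
      using t Q_sup_ge[of "\<lambda>x. ereal (\<psi> x)" "y1 + z" c y1] Q_sup_ge[of "\<lambda>x. ereal (\<psi> x)" "y2 + z" c y2]
      by (intro add_mono ereal_mult_left_mono) (auto simp: cost_def)
    finally show "ereal (\<psi> x) - ereal (c x ((1 - t) *\<^sub>R y1 + t *\<^sub>R y2)) \<le> ereal (1 - t) * ?\<phi> y1 + ereal t * ?\<phi> y2"
      by (simp add: cost_def z_def)
  qed
  ultimately show ?thesis by (auto simp: ereal_convex_def)
qed

text \<open>The supremum is uncountable, but each of its terms is continuous in \<open>y\<close>; so
  the strict superlevel sets are unions of open sets, and the transform is lower
  semicontinuous.\<close>

lemma Q_sup_measurable: "Q_sup c (\<lambda>x. ereal (\<psi> x)) \<in> borel_measurable \<nu>"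
  unfolding borel_measurable_\<nu>
proof (rule borel_measurableI_greater)
  fix a
  have "open {y. a < ereal (\<psi> x - h (x - y))}" for x
    by (intro open_Collect_less continuous_on_ereal continuous_intros
        continuous_on_compose2[OF h_continuous]) auto
  then have "open (\<Union>x. {y. a < ereal (\<psi> x - h (x - y))})" by blast
  moreover have "(\<Union>x. {y. a < ereal (\<psi> x - h (x - y))}) = {y \<in> space borel. a < Q_sup c (\<lambda>x. ereal (\<psi> x)) y}"
    by (auto simp: Q_sup_def less_SUP_iff cost_def)
  ultimately show "{y \<in> space borel. a < Q_sup c (\<lambda>x. ereal (\<psi> x)) y} \<in> sets borel"
    by (metis borel_open)
qed

text \<open>One finite value of \<open>\<phi>\<close> bounds the infimum by a translate of
  \<open>h\<close>, which has the right growth.\<close>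

lemma Q_inf_in_C_b:
  assumes \<phi>: "ereal_convex \<phi>" and r: "\<phi> y = ereal r" and \<psi>: "\<And>x. Q_inf c \<phi> x = ereal (\<psi> x)"
  shows "\<psi> \<in> convex_functions \<inter> C_b p"
proof (rule convex_C_bI[OF _ p])
  show "convex_on UNIV \<psi>" by (rule Q_inf_convex_on[OF \<phi> h_convex \<psi>])
  fix x
  have "\<psi> x \<le> r + h (x - y)"
    using Q_inf_le[of c \<phi> x y] by (simp add: r \<psi> cost_def)
  also have "\<dots> \<le> \<bar>r\<bar> * weight p x + K * 2 powr p * weight p x * weight p y"
    using mult_left_mono[OF weight_ge_1[of p x], of "\<bar>r\<bar>"] h_diff_le[of x y] by simp
  finally show "\<psi> x \<le> (\<bar>r\<bar> + K * 2 powr p * weight p y) * weight p x"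
    by (simp add: algebra_simps)
qed

lemma Q_inf_ge_minus_h0: "Q_inf c \<phi> y = ereal r \<Longrightarrow> ereal (r - h 0) \<le> \<phi> y"
  using Q_inf_le[of c \<phi> y y] by (cases "\<phi> y") (auto simp: cost_def)

section \<open>Relaxing the backward problem to extended-valued potentials\<close>

lemma backward_value_real:
  assumes "f \<in> C_b p" "q \<in> C_b p" "\<And>x. Q_inf c (\<lambda>y. ereal (f y)) x = ereal (q x)"
  shows "backward_value c \<mu> \<nu> (\<lambda>y. ereal (f y)) = ereal ((\<integral>x. q x \<partial>\<mu>) - (\<integral>y. f y \<partial>\<nu>))"
proof -
  have "Q_inf c (\<lambda>y. ereal (f y)) = (\<lambda>x. ereal (q x))" using assms(3) by auto
  then show ?thesis
    using assms(1,2) by (simp add: backward_value_def ext_integral_ereal integrable_C_b[OF \<mu>] integrable_C_b[OF \<nu>])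
qed

text \<open>Admitting extended-valued potentials does not increase the dual value: the Lipschitz
  regularisations \<open>f n\<close> of \<open>\<phi>\<close> are admissible and lie below \<open>\<phi>\<close>, and since infimal convolutions
  commute, their transforms are the Lipschitz regularisations of \<open>\<psi>\<close>, which agree with \<open>\<psi>\<close> at a
  given point once \<open>n\<close> exceeds the norm of a subgradient there.\<close>
lemma backward_value_le_D_backward:
  assumes \<phi>: "\<phi> \<in> convex_L1 \<nu>" and \<psi>: "\<And>x. Q_inf c \<phi> x = ereal (\<psi> x)"
  shows "backward_value c \<mu> \<nu> \<phi> \<le> D_backward p c \<mu> \<nu>"
proof -
  have \<phi>c: "ereal_convex \<phi>" using \<phi> by (simp add: convex_L1_iff)
  obtain y0 r where r: "\<phi> y0 = ereal r" using convex_L1_finite_point[OF \<phi> prob_\<nu>] .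
  have \<psi>C: "\<psi> \<in> convex_functions \<inter> C_b p" by (rule Q_inf_in_C_b[OF \<phi>c r \<psi>])
  then have \<psi>_convex: "convex_on UNIV \<psi>" by (simp add: convex_functions_def)
  obtain g where g: "\<And>y. \<psi> 0 + g \<bullet> (y - 0) \<le> \<psi> y" using convex_on_subgradient[OF \<psi>_convex] by blast
  define k where "k n z = real n * norm z" for n and z :: 'a
  have k_convex: "convex_on UNIV (k n)" for n
    unfolding k_def[abs_def] using convex_on_dist[of UNIV "0::'a"] by (intro convex_on_cmul) auto
  \<comment> \<open>For small \<open>n\<close> the infimum may be minus infinity, and the real value
    is then the default 0; every fact about \<open>f n\<close> below therefore assumes
    \<open>N \<le> n\<close>.\<close>
  define f where "f n y = real_of_ereal (Q_inf (cost (k n)) \<phi> y)" for n y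
  obtain N where N: "norm g \<le> real N" using real_arch_simple by blast
  have cs: "0 \<le> v \<bullet> (z - y) + real n * norm (y - z)" if "norm v \<le> real n" for v z y :: 'a and n
  proof -
    have "\<bar>v \<bullet> (z - y)\<bar> \<le> norm v * norm (y - z)" using Cauchy_Schwarz_ineq2[of v "z - y"] by (simp add: norm_minus_commute)
    also have "\<dots> \<le> real n * norm (y - z)" using that by (intro mult_right_mono) auto
    finally show ?thesis by linarith
  qed
  have fin: "Q_inf (cost (k n)) \<phi> y = ereal (f n y)" if n: "N \<le> n" for n y
  proof -
    \<comment> \<open>An affine minorant of slope at most \<open>n\<close> survives the
      regularisation; the one used here comes from \<open>\<psi>\<close> through the diagonal bound
      \<open>\<psi> z - h 0\<close> \<le> \<open>\<phi> z\<close>.\<close>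
    have "ereal (\<psi> 0 - h 0 + g \<bullet> y) \<le> Q_inf (cost (k n)) \<phi> y"
      unfolding Q_inf_def
    proof (rule INF_greatest)
      fix z
      have "0 \<le> g \<bullet> (z - y) + real n * norm (y - z)" using N n by (intro cs) linarith
      then have "ereal (\<psi> 0 - h 0 + g \<bullet> y) \<le> ereal (\<psi> z - h 0) + ereal (cost (k n) y z)"
        using g[of z] by (simp add: inner_diff_right cost_def k_def)
      also have "\<dots> \<le> \<phi> z + ereal (cost (k n) y z)"
        by (intro add_mono Q_inf_ge_minus_h0 \<psi>) auto
      finally show "ereal (\<psi> 0 - h 0 + g \<bullet> y) \<le> \<phi> z + ereal (cost (k n) y z)" .
    qed
    moreover have "Q_inf (cost (k n)) \<phi> y \<le> ereal (r + cost (k n) y y0)"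
      using Q_inf_le[of "cost (k n)" \<phi> y y0] by (simp add: r)
    ultimately show ?thesis unfolding f_def by (cases "Q_inf (cost (k n)) \<phi> y") auto
  qed
  have f_C: "f n \<in> convex_functions \<inter> C_b p" if n: "N \<le> n" for n
  proof (rule convex_C_bI[OF _ p])
    show "convex_on UNIV (f n)" by (rule Q_inf_convex_on[OF \<phi>c k_convex fin[OF n]])
    fix x
    have "f n x \<le> r + real n * norm (x - y0)"
      using Q_inf_le[of "cost (k n)" \<phi> x y0] by (simp add: r fin[OF n] cost_def k_def)
    also have "\<dots> \<le> \<bar>r\<bar> + real n * (norm x + norm y0)"
      by (intro add_mono mult_left_mono norm_triangle_ineq4) auto
    also have "\<dots> \<le> \<bar>r\<bar> * weight p x + real n * (weight p x + norm y0 * weight p x)"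
      using mult_left_mono[OF weight_ge_1[of p x], of "\<bar>r\<bar>"] mult_left_mono[OF weight_ge_1[of p x], of "norm y0"]
      by (intro add_mono mult_left_mono norm_le_weight[OF p]) auto
    finally show "f n x \<le> (\<bar>r\<bar> + real n * (1 + norm y0)) * weight p x"
      by (simp add: algebra_simps)
  qed
  have f_le: "ereal (f n y) \<le> \<phi> y" if n: "N \<le> n" for n y
    using Q_inf_le[of "cost (k n)" \<phi> y y] by (simp add: fin[OF n] cost_def k_def)
  \<comment> \<open>Only affine minorants of \<open>\<psi>\<close> with slope at most
    \<open>n\<close> need to be carried through the two infima. The choice below of
    \<open>x - y + z\<close> as the point where \<open>\<psi>\<close> is tested moves the
    displacement from \<open>y\<close> to \<open>z\<close> into the first variable.\<close>
  have Q_ge: "ereal (a + v \<bullet> x) \<le> Q_inf c (\<lambda>y. ereal (f n y)) x"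
    if n: "N \<le> n" and v: "norm v \<le> real n" and a: "\<And>x. a + v \<bullet> x \<le> \<psi> x" for a v n x
    unfolding Q_inf_def[of c]
  proof (rule INF_greatest)
    fix y
    have "ereal (a + v \<bullet> x - h (x - y)) \<le> Q_inf (cost (k n)) \<phi> y"
      unfolding Q_inf_def
    proof (rule INF_greatest)
      fix z
      have "ereal (\<psi> (x - y + z)) \<le> \<phi> z + ereal (h (x - y))"
        using Q_inf_le[of c \<phi> "x - y + z" z] by (simp add: \<psi> cost_def)
      moreover have "a + v \<bullet> x \<le> \<psi> (x - y + z) + real n * norm (y - z)"
        using a[of "x - y + z"] cs[OF v, of z y] by (simp add: inner_diff_right inner_add_right)
      ultimately show "ereal (a + v \<bullet> x - h (x - y)) \<le> \<phi> z + ereal (cost (k n) y z)"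
        by (cases "\<phi> z") (auto simp: cost_def k_def)
    qed
    then show "ereal (a + v \<bullet> x) \<le> ereal (f n y) + ereal (c x y)"
      by (simp add: fin[OF n] cost_def)
  qed
  define q where "q n x = real_of_ereal (Q_inf c (\<lambda>y. ereal (f n y)) x)" for n x
  have Q_le: "Q_inf c (\<lambda>y. ereal (f n y)) x \<le> ereal (\<psi> x)" if n: "N \<le> n" for n x
    unfolding \<psi>[symmetric] by (rule Q_inf_mono) (rule f_le[OF n])
  have Q_ge0: "ereal (\<psi> 0 + g \<bullet> x) \<le> Q_inf c (\<lambda>y. ereal (f n y)) x" if n: "N \<le> n" for n x
    using n N g by (intro Q_ge) auto
  have q: "Q_inf c (\<lambda>y. ereal (f n y)) x = ereal (q n x)" if n: "N \<le> n" for n x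
    using Q_le[OF n, of x] Q_ge0[OF n, of x]
    unfolding q_def by (cases "Q_inf c (\<lambda>y. ereal (f n y)) x") auto
  have q_C: "q n \<in> convex_functions \<inter> C_b p" if n: "N \<le> n" for n
    using f_C[OF n] by (intro Q_inf_in_C_b[OF convex_on_imp_ereal_convex _ q[OF n]]) (auto simp: convex_functions_def)
  have lim: "(\<lambda>n. q n x) \<longlonglongrightarrow> \<psi> x" for x
  proof -
    obtain v where v: "\<And>y. \<psi> x + v \<bullet> (y - x) \<le> \<psi> y" using convex_on_subgradient[OF \<psi>_convex] by blast
    obtain N' where N': "norm v \<le> real N'" using real_arch_simple by blast
    have "q n x = \<psi> x" if n: "n \<ge> max N N'" for n
    proof -
      have "ereal ((\<psi> x - v \<bullet> x) + v \<bullet> x) \<le> Q_inf c (\<lambda>y. ereal (f n y)) x"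
        using n N' v by (intro Q_ge) (auto simp: inner_diff_right algebra_simps)
      then show ?thesis using Q_le[of n x] n by (simp add: q)
    qed
    then show ?thesis
      by (intro tendsto_eventually eventually_sequentiallyI[of "max N N'"]) blast
  qed
  have \<psi>I: "integrable \<mu> \<psi>" using \<psi>C by (intro integrable_C_b[OF \<mu>]) auto
  \<comment> \<open>The affine function \<open>l\<close> below and \<open>\<psi>\<close> above
    enclose all \<open>q n\<close> with \<open>N \<le> n\<close> and provide the dominating
    function.\<close>
  define l where "l x = \<psi> 0 + g \<bullet> x" for x
  have l_C: "l \<in> C_b p"
  proof -
    have "\<bar>l x\<bar> \<le> (\<bar>\<psi> 0\<bar> + norm g) * weight p x" for x
    proof -
      have "\<bar>g \<bullet> x\<bar> \<le> norm g * weight p x"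
        using Cauchy_Schwarz_ineq2[of g x] mult_left_mono[OF norm_le_weight[OF p, of x], of "norm g"] by simp
      moreover have "\<bar>\<psi> 0\<bar> \<le> \<bar>\<psi> 0\<bar> * weight p x"
        using mult_left_mono[OF weight_ge_1[of p x], of "\<bar>\<psi> 0\<bar>"] by simp
      ultimately show ?thesis by (simp add: l_def algebra_simps)
    qed
    then show ?thesis by (auto simp: C_b_iff l_def intro!: continuous_intros)
  qed
  have "(\<lambda>n. \<integral>x. q (n + N) x \<partial>\<mu>) \<longlonglongrightarrow> (\<integral>x. \<psi> x \<partial>\<mu>)"
  proof (rule integral_dominated_convergence)
    show "\<psi> \<in> borel_measurable \<mu>" using \<psi>I by auto
    show "q (n + N) \<in> borel_measurable \<mu>" for n
      using integrable_C_b[OF \<mu>, of "q (n + N)"] q_C[of "n + N"] by auto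
    show "integrable \<mu> (\<lambda>x. \<bar>l x\<bar> + \<bar>\<psi> x\<bar>)"
      using \<psi>I integrable_C_b[OF \<mu> l_C] by auto
    show "AE x in \<mu>. (\<lambda>n. q (n + N) x) \<longlonglongrightarrow> \<psi> x"
      using lim by (auto intro!: AE_I2 LIMSEQ_ignore_initial_segment)
    show "AE x in \<mu>. norm (q (n + N) x) \<le> \<bar>l x\<bar> + \<bar>\<psi> x\<bar>" for n
    proof (rule AE_I2)
      fix x
      have "q (n + N) x \<le> \<psi> x" "l x \<le> q (n + N) x"
        using Q_le[of "n + N" x] Q_ge0[of "n + N" x] by (simp_all add: q l_def)
      then show "norm (q (n + N) x) \<le> \<bar>l x\<bar> + \<bar>\<psi> x\<bar>" by simp
    qed
  qed
  then have "(\<lambda>n. ereal ((\<integral>x. q (n + N) x \<partial>\<mu>) - (\<integral>y. real_of_ereal (\<phi> y) \<partial>\<nu>)))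
      \<longlonglongrightarrow> ereal ((\<integral>x. \<psi> x \<partial>\<mu>) - (\<integral>y. real_of_ereal (\<phi> y) \<partial>\<nu>))"
    by (intro tendsto_intros)
  moreover have "ereal ((\<integral>x. q (n + N) x \<partial>\<mu>) - (\<integral>y. real_of_ereal (\<phi> y) \<partial>\<nu>)) \<le> D_backward p c \<mu> \<nu>" for n
  proof -
    have n: "N \<le> n + N" by simp
    have "ext_integral \<nu> (\<lambda>y. ereal (f (n + N) y)) \<le> ext_integral \<nu> \<phi>"
      by (rule ext_integral_mono) (rule f_le[OF n])
    then have "(\<integral>y. f (n + N) y \<partial>\<nu>) \<le> (\<integral>y. real_of_ereal (\<phi> y) \<partial>\<nu>)"
      using f_C[OF n] \<phi> by (simp add: ext_integral_ereal integrable_C_b[OF \<nu>] ext_integral_real_of_ereal(3) convex_L1_iff)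
    then have "ereal ((\<integral>x. q (n + N) x \<partial>\<mu>) - (\<integral>y. real_of_ereal (\<phi> y) \<partial>\<nu>))
      \<le> backward_value c \<mu> \<nu> (\<lambda>y. ereal (f (n + N) y))"
      using f_C[OF n] q_C[OF n] by (subst backward_value_real[OF _ _ q[OF n]]) auto
    also have "\<dots> \<le> D_backward p c \<mu> \<nu>"
      unfolding D_backward_def by (rule SUP_upper[OF f_C[OF n]])
    finally show ?thesis .
  qed
  ultimately have "ereal ((\<integral>x. \<psi> x \<partial>\<mu>) - (\<integral>y. real_of_ereal (\<phi> y) \<partial>\<nu>)) \<le> D_backward p c \<mu> \<nu>"
    by - (erule LIMSEQ_le_const2, blast)
  moreover have "Q_inf c \<phi> = (\<lambda>x. ereal (\<psi> x))" using \<psi> by auto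
  ultimately show ?thesis
    using \<phi> by (simp add: backward_value_def ext_integral_ereal[OF \<psi>I] ext_integral_real_of_ereal(3) convex_L1_iff)
qed


section \<open>Conjugate pairs and equality of the two suprema\<close>

lemma forward_value_real:
  assumes \<psi>: "\<psi> \<in> C_b p" and \<phi>: "Q_sup c (\<lambda>x. ereal (\<psi> x)) \<in> convex_L1 \<nu>"
  shows "forward_value c \<mu> \<nu> (\<lambda>x. ereal (\<psi> x)) =
    ereal ((\<integral>x. \<psi> x \<partial>\<mu>) - (\<integral>y. real_of_ereal (Q_sup c (\<lambda>x. ereal (\<psi> x)) y) \<partial>\<nu>))"
  using \<phi> unfolding forward_value_def ext_integral_ereal[OF integrable_C_b[OF \<mu> \<psi>]]
  by (simp add: ext_integral_real_of_ereal(3) convex_L1_iff)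

lemma backward_value_L1:
  assumes \<psi>: "\<psi> \<in> C_b p" "\<And>x. Q_inf c \<phi> x = ereal (\<psi> x)" and \<phi>: "\<phi> \<in> convex_L1 \<nu>"
  shows "backward_value c \<mu> \<nu> \<phi> = ereal ((\<integral>x. \<psi> x \<partial>\<mu>) - (\<integral>y. real_of_ereal (\<phi> y) \<partial>\<nu>))"
proof -
  have "Q_inf c \<phi> = (\<lambda>x. ereal (\<psi> x))" using \<psi>(2) by auto
  then show ?thesis
    using \<phi> unfolding backward_value_def
    by (simp add: ext_integral_ereal[OF integrable_C_b[OF \<mu> \<psi>(1)]] ext_integral_real_of_ereal(3) convex_L1_iff)
qed

text \<open>The integrable minorant \<open>\<psi> y - h 0\<close> controls the transform from below,
  so only its growth upwards could destroy integrability.\<close>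

lemma Q_sup_convex_L1:
  assumes \<psi>: "\<psi> \<in> convex_functions \<inter> C_b p"
    and fin: "ext_integral \<nu> (Q_sup c (\<lambda>x. ereal (\<psi> x))) \<noteq> \<infinity>"
  shows "Q_sup c (\<lambda>x. ereal (\<psi> x)) \<in> convex_L1 \<nu>"
proof -
  interpret prob_space \<nu> by (rule prob_\<nu>)
  have "integrable \<nu> (\<lambda>y. \<psi> y - h 0)"
    using integrable_C_b[OF \<nu>] \<psi> by auto
  from ext_integral_finite_imp_L1[OF Q_sup_measurable this Q_sup_ge_minus_h0 fin]
  show ?thesis
    using ereal_convex_Q_sup \<psi> Q_sup_measurable by (simp add: convex_L1_iff convex_functions_def)
qed

lemma Q_inf_Q_sup_real:
  assumes \<psi>: "\<psi> \<in> convex_functions \<inter> C_b p"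
    and \<phi>: "Q_sup c (\<lambda>x. ereal (\<psi> x)) \<in> convex_L1 \<nu>"
  obtains \<psi>' where "\<psi>' \<in> convex_functions \<inter> C_b p"
    "\<And>x. Q_inf c (Q_sup c (\<lambda>x. ereal (\<psi> x))) x = ereal (\<psi>' x)" "\<And>x. \<psi> x \<le> \<psi>' x"
proof -
  let ?\<phi> = "Q_sup c (\<lambda>x. ereal (\<psi> x))"
  obtain y r where r: "?\<phi> y = ereal r" using convex_L1_finite_point[OF \<phi> prob_\<nu>] .
  define \<psi>' where "\<psi>' x = real_of_ereal (Q_inf c ?\<phi> x)" for x
  have *: "Q_inf c ?\<phi> x = ereal (\<psi>' x)" for x
    using Q_inf_le[of c ?\<phi> x y] le_Q_inf_Q_sup[of \<psi> x c] r
    unfolding \<psi>'_def by (cases "Q_inf c ?\<phi> x") auto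
  show ?thesis
  proof (rule that[OF _ *])
    show "\<psi>' \<in> convex_functions \<inter> C_b p"
      using \<phi> r * by (intro Q_inf_in_C_b[of ?\<phi>]) (auto simp: convex_L1_iff)
    show "\<psi> x \<le> \<psi>' x" for x
      using le_Q_inf_Q_sup[of \<psi> x c] by (simp add: *)
  qed
qed

definition conjugate_pair :: "('a \<Rightarrow> real) \<Rightarrow> ('a \<Rightarrow> ereal) \<Rightarrow> bool" where
  "conjugate_pair \<psi> \<phi> \<longleftrightarrow> (\<psi>, \<phi>) \<in> S_class p \<nu> \<and>
     (\<forall>y. \<phi> y = Q_sup c (\<lambda>x. ereal (\<psi> x)) y) \<and> (\<forall>x. ereal (\<psi> x) = Q_inf c \<phi> x)"

lemma conjugate_pairD:
  assumes "conjugate_pair \<psi> \<phi>"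
  shows "\<psi> \<in> convex_functions \<inter> C_b p" "\<phi> \<in> convex_L1 \<nu>" "Q_inf c \<phi> x = ereal (\<psi> x)"
    "Q_sup c (\<lambda>x. ereal (\<psi> x)) = \<phi>"
  using assms unfolding conjugate_pair_def S_class_def fun_eq_iff by (blast, blast, metis, metis)

text \<open>A third transform gives nothing new: raising \<open>\<psi>\<close> to its biconjugate
  leaves \<open>Q_sup\<close> unchanged, so a single step reaches a pair of exact
  conjugates.\<close>

lemma conjugate_pair_Q_inf:
  assumes \<psi>: "\<psi> \<in> convex_functions \<inter> C_b p"
    and \<phi>: "Q_sup c (\<lambda>x. ereal (\<psi> x)) \<in> convex_L1 \<nu>"
  obtains \<psi>' where "conjugate_pair \<psi>' (Q_sup c (\<lambda>x. ereal (\<psi> x)))" "\<And>x. \<psi> x \<le> \<psi>' x"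
proof -
  let ?\<phi> = "Q_sup c (\<lambda>x. ereal (\<psi> x))"
  obtain \<psi>' where \<psi>': "\<psi>' \<in> convex_functions \<inter> C_b p" "\<And>x. Q_inf c ?\<phi> x = ereal (\<psi>' x)" "\<And>x. \<psi> x \<le> \<psi>' x"
    using Q_inf_Q_sup_real[OF \<psi> \<phi>] by blast
  have eq: "Q_inf c ?\<phi> = (\<lambda>x. ereal (\<psi>' x))" using \<psi>'(2) by auto
  have "?\<phi> y = Q_sup c (\<lambda>x. ereal (\<psi>' x)) y" for y
  proof (rule antisym)
    show "?\<phi> y \<le> Q_sup c (\<lambda>x. ereal (\<psi>' x)) y" by (rule Q_sup_mono) (simp add: \<psi>'(3))
    show "Q_sup c (\<lambda>x. ereal (\<psi>' x)) y \<le> ?\<phi> y" using Q_sup_Q_inf_le[of c ?\<phi> y] by (simp add: eq)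
  qed
  then have "conjugate_pair \<psi>' ?\<phi>"
    using \<psi>'(1) \<phi> unfolding conjugate_pair_def S_class_def eq by blast
  then show ?thesis using \<psi>'(3) by (rule that)
qed

text \<open>Here \<open>\<psi>\<close> stays and \<open>\<phi>\<close> is lowered. Integrability is
  inherited from \<open>\<phi>\<close> above and from the diagonal bound below.\<close>

lemma conjugate_pair_Q_sup:
  assumes \<psi>: "\<psi> \<in> convex_functions \<inter> C_b p" "\<And>x. ereal (\<psi> x) = Q_inf c \<phi> x"
    and \<phi>: "\<phi> \<in> convex_L1 \<nu>"
  shows "conjugate_pair \<psi> (Q_sup c (\<lambda>x. ereal (\<psi> x)))"
    and "\<And>y. Q_sup c (\<lambda>x. ereal (\<psi> x)) y \<le> \<phi> y"
proof -
  let ?\<phi> = "Q_sup c (\<lambda>x. ereal (\<psi> x))"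
  have eq: "Q_inf c \<phi> = (\<lambda>x. ereal (\<psi> x))" using \<psi>(2) by auto
  show le: "?\<phi> y \<le> \<phi> y" for y using Q_sup_Q_inf_le[of c \<phi> y] by (simp add: eq)
  have "ext_integral \<nu> ?\<phi> \<le> ext_integral \<nu> \<phi>" by (rule ext_integral_mono) (rule le)
  also have "\<dots> < \<infinity>" using \<phi> by (simp add: ext_integral_real_of_ereal(3) convex_L1_iff)
  finally have "?\<phi> \<in> convex_L1 \<nu>" by (intro Q_sup_convex_L1[OF \<psi>(1)]) auto
  moreover have "ereal (\<psi> x) = Q_inf c ?\<phi> x" for x
    using le_Q_inf_Q_sup[of \<psi> x c] Q_inf_mono[of ?\<phi> \<phi>, OF le, of c x]
    unfolding \<psi>(2)[symmetric] by (rule antisym)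
  ultimately show "conjugate_pair \<psi> ?\<phi>"
    using \<psi>(1) unfolding conjugate_pair_def S_class_def by blast
qed

lemma conjugate_pair_values:
  assumes "conjugate_pair \<psi> \<phi>"
  shows "forward_value c \<mu> \<nu> (\<lambda>x. ereal (\<psi> x)) = ereal ((\<integral>x. \<psi> x \<partial>\<mu>) - (\<integral>y. real_of_ereal (\<phi> y) \<partial>\<nu>))"
    and "backward_value c \<mu> \<nu> \<phi> = ereal ((\<integral>x. \<psi> x \<partial>\<mu>) - (\<integral>y. real_of_ereal (\<phi> y) \<partial>\<nu>))"
proof -
  note * = conjugate_pairD[OF assms]
  have \<psi>: "\<psi> \<in> C_b p" using *(1) by blast
  show "forward_value c \<mu> \<nu> (\<lambda>x. ereal (\<psi> x)) = ereal ((\<integral>x. \<psi> x \<partial>\<mu>) - (\<integral>y. real_of_ereal (\<phi> y) \<partial>\<nu>))"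
    using forward_value_real[OF \<psi>] *(2) by (simp add: *(4))
  show "backward_value c \<mu> \<nu> \<phi> = ereal ((\<integral>x. \<psi> x \<partial>\<mu>) - (\<integral>y. real_of_ereal (\<phi> y) \<partial>\<nu>))"
    by (rule backward_value_L1[OF \<psi> *(3,2)])
qed

text \<open>If the transform has infinite integral, the forward value is minus infinity. Otherwise
  biconjugation does not lower the value, and the resulting potential, which may be infinite at some
  points, is covered by \<open>backward_value_le_D_backward\<close>.\<close>

lemma D_forward_le_D_backward: "D_forward p c \<mu> \<nu> \<le> D_backward p c \<mu> \<nu>"
  unfolding D_forward_def
proof (rule SUP_least)
  fix \<psi> :: "'a \<Rightarrow> real" assume \<psi>: "\<psi> \<in> convex_functions \<inter> C_b p"
  let ?\<phi> = "Q_sup c (\<lambda>x. ereal (\<psi> x))"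
  show "forward_value c \<mu> \<nu> (\<lambda>x. ereal (\<psi> x)) \<le> D_backward p c \<mu> \<nu>"
  proof (cases "ext_integral \<nu> ?\<phi> = \<infinity>")
    case True
    then show ?thesis
      using \<psi> by (simp add: forward_value_def ext_integral_ereal integrable_C_b[OF \<mu>])
  next
    case False
    then have \<phi>: "?\<phi> \<in> convex_L1 \<nu>" by (rule Q_sup_convex_L1[OF \<psi>])
    obtain \<psi>' where \<psi>': "conjugate_pair \<psi>' ?\<phi>" "\<And>x. \<psi> x \<le> \<psi>' x"
      using conjugate_pair_Q_inf[OF \<psi> \<phi>] by blast
    have "(\<integral>x. \<psi> x \<partial>\<mu>) \<le> (\<integral>x. \<psi>' x \<partial>\<mu>)"
      using \<psi> \<psi>'(2) conjugate_pairD(1)[OF \<psi>'(1)] by (intro integral_mono integrable_C_b[OF \<mu>]) auto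
    then have "forward_value c \<mu> \<nu> (\<lambda>x. ereal (\<psi> x)) \<le> backward_value c \<mu> \<nu> ?\<phi>"
      using \<psi> \<phi> \<psi>' by (simp add: forward_value_real conjugate_pair_values)
    also have "\<dots> \<le> D_backward p c \<mu> \<nu>"
      by (rule backward_value_le_D_backward[OF conjugate_pairD(2,3)[OF \<psi>'(1)]])
    finally show ?thesis .
  qed
qed

text \<open>There is no mixed case, since one value minus infinity of the transform spreads to all
  points.\<close>

lemma Q_inf_real_or_backward_value_minus_infinity:
  assumes f: "f \<in> convex_functions \<inter> C_b p"
  obtains "backward_value c \<mu> \<nu> (\<lambda>y. ereal (f y)) = - \<infinity>"
  | q where "q \<in> convex_functions \<inter> C_b p" "\<And>x. Q_inf c (\<lambda>y. ereal (f y)) x = ereal (q x)"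
proof (cases "\<exists>x. Q_inf c (\<lambda>y. ereal (f y)) x = - \<infinity>")
  case True
  interpret prob_space \<mu> using \<mu> by (simp add: P_moment_def)
  have fc: "ereal_convex (\<lambda>y. ereal (f y))"
    using f by (intro convex_on_imp_ereal_convex) (simp add: convex_functions_def)
  have "Q_inf c (\<lambda>y. ereal (f y)) x = - \<infinity>" for x
  proof -
    obtain x0 where "Q_inf c (\<lambda>y. ereal (f y)) x0 = - \<infinity>" using True by blast
    then show ?thesis by (rule Q_inf_minus_infinity[OF fc h_convex, rotated]) simp
  qed
  then have "Q_inf c (\<lambda>y. ereal (f y)) = (\<lambda>x. - \<infinity>)" by auto
  then have "ext_integral \<mu> (Q_inf c (\<lambda>y. ereal (f y))) = - \<infinity>"
    by (simp add: ext_integral_def emeasure_space_1 e2ennreal_neg zero_ennreal.rep_eq)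
  then have "backward_value c \<mu> \<nu> (\<lambda>y. ereal (f y)) = - \<infinity>"
    using f by (simp add: backward_value_def ext_integral_ereal integrable_C_b[OF \<nu>])
  then show ?thesis by (rule that(1))
next
  case False
  define q where "q x = real_of_ereal (Q_inf c (\<lambda>y. ereal (f y)) x)" for x
  have q: "Q_inf c (\<lambda>y. ereal (f y)) x = ereal (q x)" for x
    using False Q_inf_le[of c "\<lambda>y. ereal (f y)" x x]
    unfolding q_def by (cases "Q_inf c (\<lambda>y. ereal (f y)) x") auto
  then have "q \<in> convex_functions \<inter> C_b p"
    using f by (intro Q_inf_in_C_b[OF convex_on_imp_ereal_convex]) (auto simp: convex_functions_def)
  then show ?thesis using q by (rule that(2))
qed

text \<open>The infimal transform \<open>q\<close> of \<open>f\<close> is itself an admissible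
  forward potential, and \<open>Q_sup c q\<close> \<le> \<open>f\<close> makes its forward value at
  least as large.\<close>

lemma D_backward_le_D_forward: "D_backward p c \<mu> \<nu> \<le> D_forward p c \<mu> \<nu>"
  unfolding D_backward_def
proof (rule SUP_least)
  fix f :: "'a \<Rightarrow> real" assume f: "f \<in> convex_functions \<inter> C_b p"
  from f show "backward_value c \<mu> \<nu> (\<lambda>y. ereal (f y)) \<le> D_forward p c \<mu> \<nu>"
  proof (cases rule: Q_inf_real_or_backward_value_minus_infinity)
    case (2 q)
    have eq: "Q_inf c (\<lambda>y. ereal (f y)) = (\<lambda>x. ereal (q x))" using 2(2) by auto
    have "Q_sup c (\<lambda>x. ereal (q x)) y \<le> ereal (f y)" for y
      using Q_sup_Q_inf_le[of c "\<lambda>y. ereal (f y)" y] by (simp add: eq)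
    then have "backward_value c \<mu> \<nu> (\<lambda>y. ereal (f y)) \<le> forward_value c \<mu> \<nu> (\<lambda>x. ereal (q x))"
      unfolding backward_value_def forward_value_def eq by (intro ereal_minus_mono ext_integral_mono) auto
    also have "\<dots> \<le> D_forward p c \<mu> \<nu>"
      unfolding D_forward_def by (rule SUP_upper[OF 2(1)])
    finally show ?thesis .
  qed simp
qed

lemma D_backward_eq_D_forward: "D_backward p c \<mu> \<nu> = D_forward p c \<mu> \<nu>"
  by (rule antisym[OF D_backward_le_D_forward D_forward_le_D_backward])

lemma forward_value_le: "\<psi> \<in> convex_functions \<inter> C_b p \<Longrightarrow> forward_value c \<mu> \<nu> (\<lambda>x. ereal (\<psi> x)) \<le> D_forward p c \<mu> \<nu>"
  unfolding D_forward_def by (rule SUP_upper)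

lemma conjugate_pair_optimal:
  assumes "conjugate_pair \<psi> \<phi>" and "D_forward p c \<mu> \<nu> \<le> forward_value c \<mu> \<nu> (\<lambda>x. ereal (\<psi> x))"
  shows "optimal_backward_pair p c \<mu> \<nu> \<psi> \<phi>" and "optimal_forward_pair p c \<mu> \<nu> \<psi> \<phi>"
proof -
  have "forward_value c \<mu> \<nu> (\<lambda>x. ereal (\<psi> x)) = D_forward p c \<mu> \<nu>"
    using assms conjugate_pairD(1) by (intro antisym forward_value_le)
  moreover from this have "backward_value c \<mu> \<nu> \<phi> = D_backward p c \<mu> \<nu>"
    using conjugate_pair_values[OF assms(1)] D_backward_eq_D_forward by simp
  ultimately show "optimal_backward_pair p c \<mu> \<nu> \<psi> \<phi>" "optimal_forward_pair p c \<mu> \<nu> \<psi> \<phi>"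
    using assms(1) unfolding optimal_backward_pair_def optimal_forward_pair_def conjugate_pair_def S_class_def
    by blast+
qed

text \<open>The biconjugate lies above \<open>\<psi>\<close> pointwise, yet optimality prevents a
  larger integral; two ordered functions with equal integrals agree almost everywhere.\<close>

lemma forward_optimal_imp_conjugate:
  assumes \<psi>: "\<psi> \<in> convex_functions \<inter> C_b p"
    and \<phi>: "Q_sup c (\<lambda>x. ereal (\<psi> x)) \<in> convex_L1 \<nu>"
    and opt: "D_forward p c \<mu> \<nu> \<le> forward_value c \<mu> \<nu> (\<lambda>x. ereal (\<psi> x))"
  obtains \<psi>' where "conjugate_pair \<psi>' (Q_sup c (\<lambda>x. ereal (\<psi> x)))" "AE x in \<mu>. \<psi>' x = \<psi> x"
    "D_forward p c \<mu> \<nu> \<le> forward_value c \<mu> \<nu> (\<lambda>x. ereal (\<psi>' x))"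
proof -
  let ?\<phi> = "Q_sup c (\<lambda>x. ereal (\<psi> x))"
  obtain \<psi>' where \<psi>': "conjugate_pair \<psi>' ?\<phi>" "\<And>x. \<psi> x \<le> \<psi>' x"
    using conjugate_pair_Q_inf[OF \<psi> \<phi>] by blast
  have \<psi>'C: "\<psi>' \<in> convex_functions \<inter> C_b p" by (rule conjugate_pairD(1)[OF \<psi>'(1)])
  have I: "integrable \<mu> \<psi>" "integrable \<mu> \<psi>'" using \<psi> \<psi>'C by (auto intro: integrable_C_b[OF \<mu>])
  have le: "(\<integral>x. \<psi> x \<partial>\<mu>) \<le> (\<integral>x. \<psi>' x \<partial>\<mu>)"
    using I \<psi>'(2) by (intro integral_mono)
  have "forward_value c \<mu> \<nu> (\<lambda>x. ereal (\<psi>' x)) \<le> forward_value c \<mu> \<nu> (\<lambda>x. ereal (\<psi> x))"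
    using forward_value_le[OF \<psi>'C] opt by simp
  then have "(\<integral>x. \<psi>' x \<partial>\<mu>) \<le> (\<integral>x. \<psi> x \<partial>\<mu>)"
    using \<psi> \<phi> conjugate_pair_values(1)[OF \<psi>'(1)] by (simp add: forward_value_real)
  then have "AE x in \<mu>. \<psi> x = \<psi>' x" using I \<psi>'(2) by (intro AE_eq_of_integral_eq) auto
  then have "AE x in \<mu>. \<psi>' x = \<psi> x" by eventually_elim simp
  moreover have "forward_value c \<mu> \<nu> (\<lambda>x. ereal (\<psi> x)) \<le> forward_value c \<mu> \<nu> (\<lambda>x. ereal (\<psi>' x))"
    using \<psi> \<phi> conjugate_pair_values(1)[OF \<psi>'(1)] le by (simp add: forward_value_real)
  ultimately show ?thesis by (intro that[OF \<psi>'(1)] order_trans[OF opt])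
qed

text \<open>The same squeeze on the other side: \<open>\<phi>\<close> is lowered to the transform of
  \<open>\<psi>\<close>, and optimality prevents a smaller integral. The upper bound on the new
  value needs the relaxed class, as the new potential may be infinite at some points.\<close>

lemma backward_optimal_imp_conjugate:
  assumes \<psi>: "\<psi> \<in> convex_functions \<inter> C_b p" "\<And>x. ereal (\<psi> x) = Q_inf c \<phi> x"
    and \<phi>: "\<phi> \<in> convex_L1 \<nu>" and opt: "D_backward p c \<mu> \<nu> \<le> backward_value c \<mu> \<nu> \<phi>"
  shows "conjugate_pair \<psi> (Q_sup c (\<lambda>x. ereal (\<psi> x)))"
    and "AE y in \<nu>. Q_sup c (\<lambda>x. ereal (\<psi> x)) y = \<phi> y"
    and "D_forward p c \<mu> \<nu> \<le> forward_value c \<mu> \<nu> (\<lambda>x. ereal (\<psi> x))"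
proof -
  let ?\<phi> = "Q_sup c (\<lambda>x. ereal (\<psi> x))"
  show cp: "conjugate_pair \<psi> ?\<phi>" by (rule conjugate_pair_Q_sup(1)[OF \<psi> \<phi>])
  have le: "?\<phi> y \<le> \<phi> y" for y by (rule conjugate_pair_Q_sup(2)[OF \<psi> \<phi>])
  have \<phi>': "?\<phi> \<in> convex_L1 \<nu>" by (rule conjugate_pairD(2)[OF cp])
  note 1 = ext_integral_real_of_ereal[of \<phi> \<nu>] and 2 = ext_integral_real_of_ereal[of ?\<phi> \<nu>]
  have m: "\<phi> \<in> borel_measurable \<nu>" "(\<integral>\<^sup>+ y. e2ennreal \<bar>\<phi> y\<bar> \<partial>\<nu>) < \<infinity>"
    "?\<phi> \<in> borel_measurable \<nu>" "(\<integral>\<^sup>+ y. e2ennreal \<bar>?\<phi> y\<bar> \<partial>\<nu>) < \<infinity>"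
    using \<phi> \<phi>' by (auto simp: convex_L1_iff)
  have bv: "backward_value c \<mu> \<nu> \<phi> = ereal ((\<integral>x. \<psi> x \<partial>\<mu>) - (\<integral>y. real_of_ereal (\<phi> y) \<partial>\<nu>))"
    using \<psi> \<phi> by (intro backward_value_L1) auto
  have "backward_value c \<mu> \<nu> ?\<phi> \<le> D_backward p c \<mu> \<nu>"
    by (rule backward_value_le_D_backward[OF conjugate_pairD(2,3)[OF cp]])
  with opt have int: "(\<integral>y. real_of_ereal (\<phi> y) \<partial>\<nu>) \<le> (\<integral>y. real_of_ereal (?\<phi> y) \<partial>\<nu>)"
    unfolding conjugate_pair_values(2)[OF cp] bv using order_trans by fastforce
  have "AE y in \<nu>. real_of_ereal (?\<phi> y) \<le> real_of_ereal (\<phi> y)"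
    using 1(2)[OF m(1,2)] 2(2)[OF m(3,4)]
  proof eventually_elim
    case (elim y)
    then show ?case using le[of y] by (metis ereal_less_eq(3))
  qed
  then have "AE y in \<nu>. real_of_ereal (?\<phi> y) = real_of_ereal (\<phi> y)"
    using int 1(1)[OF m(1,2)] 2(1)[OF m(3,4)] by (intro AE_eq_of_integral_eq)
  with 1(2)[OF m(1,2)] 2(2)[OF m(3,4)] show "AE y in \<nu>. ?\<phi> y = \<phi> y"
    by eventually_elim metis
  have "(\<integral>y. real_of_ereal (?\<phi> y) \<partial>\<nu>) \<le> (\<integral>y. real_of_ereal (\<phi> y) \<partial>\<nu>)"
    using \<open>AE y in \<nu>. real_of_ereal (?\<phi> y) \<le> real_of_ereal (\<phi> y)\<close> 1(1)[OF m(1,2)] 2(1)[OF m(3,4)]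
    by (intro integral_mono_AE)
  then have "backward_value c \<mu> \<nu> \<phi> \<le> forward_value c \<mu> \<nu> (\<lambda>x. ereal (\<psi> x))"
    unfolding conjugate_pair_values(1)[OF cp] bv by simp
  then show "D_forward p c \<mu> \<nu> \<le> forward_value c \<mu> \<nu> (\<lambda>x. ereal (\<psi> x))"
    using opt D_backward_eq_D_forward by simp
qed

end

text \<open>Fatou's lemma, in a form whose conclusions for two different measures can be added.\<close>
lemma Fatou_eventually:
  fixes u :: "nat \<Rightarrow> 'b \<Rightarrow> real"
  assumes u: "\<And>n. integrable M (u n)" and v: "integrable M v" and l: "integrable M l"
    and lower: "\<And>n x. l x \<le> u n x"
    and lim: "AE x in M. \<forall>e>0. eventually (\<lambda>n. v x - e < u n x) sequentially"
    and e: "0 < e"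
  shows "eventually (\<lambda>n. (\<integral>x. v x \<partial>M) - e < (\<integral>x. u n x \<partial>M)) sequentially"
proof -
  \<comment> \<open>The \<open>u n\<close> need not converge, but truncated above by
    \<open>v\<close> they do, and they are then dominated as well.\<close>
  have "(\<lambda>n. \<integral>x. min (u n x) (v x) \<partial>M) \<longlonglongrightarrow> (\<integral>x. v x \<partial>M)"
  proof (rule integral_dominated_convergence)
    show "v \<in> borel_measurable M" using v by auto
    show "(\<lambda>x. min (u n x) (v x)) \<in> borel_measurable M" for n
      using v u[of n] by auto
    show "integrable M (\<lambda>x. \<bar>l x\<bar> + \<bar>v x\<bar>)" using v l by auto
    show "AE x in M. norm (min (u n x) (v x)) \<le> \<bar>l x\<bar> + \<bar>v x\<bar>" for n
    proof (rule AE_I2)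
      fix x show "norm (min (u n x) (v x)) \<le> \<bar>l x\<bar> + \<bar>v x\<bar>"
        using lower[of x n] by (auto simp: min_def)
    qed
    show "AE x in M. (\<lambda>n. min (u n x) (v x)) \<longlonglongrightarrow> v x"
      using lim
    proof eventually_elim
      case (elim x)
      show ?case
      proof (rule tendstoI)
        fix d :: real assume "0 < d"
        with elim have "eventually (\<lambda>n. v x - d < u n x) sequentially" by blast
        then show "eventually (\<lambda>n. dist (min (u n x) (v x)) (v x) < d) sequentially"
          by eventually_elim (use \<open>0 < d\<close> in \<open>auto simp: dist_real_def min_def\<close>)
      qed
    qed
  qed
  then have "eventually (\<lambda>n. (\<integral>x. v x \<partial>M) - e < (\<integral>x. min (u n x) (v x) \<partial>M)) sequentially"
    using e by (intro order_tendstoD(1)) auto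
  moreover have "(\<integral>x. min (u n x) (v x) \<partial>M) \<le> (\<integral>x. u n x \<partial>M)" for n
    using u v by (intro integral_mono) auto
  ultimately show ?thesis
    by (auto elim!: eventually_mono intro: less_le_trans)
qed

text \<open>Dividing by \<open>L x + 1\<close> turns the pointwise bounds into the uniform bound 1
  under which a diagonal subsequence can be selected; the summand 1 keeps the divisor
  positive.\<close>

lemma pointwise_bounded_convergent_subsequence:
  fixes g :: "nat \<Rightarrow> 'b \<Rightarrow> real"
  assumes "countable S" and L: "\<And>n x. \<bar>g n x\<bar> \<le> L x"
  obtains r where "strict_mono (r :: nat \<Rightarrow> nat)" "\<And>x. x \<in> S \<Longrightarrow> convergent (\<lambda>n. g (r n) x)"
proof -
  have pos: "0 \<le> L x" for x using L[of 0 x] by linarith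
  have "norm (g n x / (L x + 1)) \<le> 1" for n x
    using L[of n x] pos[of x] by (simp add: field_simps)
  then obtain r where r: "strict_mono r" "\<And>x. x \<in> S \<Longrightarrow> \<exists>l. (\<lambda>n. g (r n) x / (L x + 1)) \<longlonglongrightarrow> l"
    using function_convergent_subsequence[OF \<open>countable S\<close>, of "\<lambda>n x. g n x / (L x + 1)" 1] by metis
  have "convergent (\<lambda>n. g (r n) x)" if x: "x \<in> S" for x
  proof -
    obtain l where "(\<lambda>n. g (r n) x / (L x + 1)) \<longlonglongrightarrow> l" using r(2)[OF x] by blast
    then have "(\<lambda>n. g (r n) x / (L x + 1) * (L x + 1)) \<longlonglongrightarrow> l * (L x + 1)"
      by (intro tendsto_intros)
    moreover have "L x + 1 \<noteq> 0" using pos[of x] by linarith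
    ultimately show ?thesis by (auto simp: convergent_def)
  qed
  then show ?thesis using r(1) by (intro that)
qed

section \<open>Normalised pairs and their uniform bounds\<close>

context convex_cost
begin

text \<open>Both functions of a pair may be shifted by the same constant, so the second one is normalised
  to vanish at the barycentre of \<open>\<nu>\<close>; by Jensen's inequality its integral is then nonnegative.\<close>
definition feasible :: "('a \<Rightarrow> real) \<Rightarrow> ('a \<Rightarrow> real) \<Rightarrow> bool" where
  "feasible g f \<longleftrightarrow> g \<in> convex_functions \<inter> C_b p \<and> f \<in> convex_functions \<inter> C_b p \<and>
     f (\<integral>y. y \<partial>\<nu>) = 0 \<and> (\<forall>x y. g x \<le> f y + h (x - y))"

lemma feasibleD:
  assumes "feasible g f"
  shows "convex_on UNIV g" "integrable \<mu> g" "integrable \<nu> f" "g x \<le> f y + h (x - y)"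
    "g x \<le> h (x - (\<integral>y. y \<partial>\<nu>))" "0 \<le> (\<integral>y. f y \<partial>\<nu>)"
proof -
  have "f (\<integral>y. y \<partial>\<nu>) = 0" "\<And>x y. g x \<le> f y + h (x - y)"
    using assms by (auto simp: feasible_def)
  \<comment> \<open>The second bound takes \<open>y\<close> to be the barycentre, where
    \<open>f\<close> vanishes.\<close>
  then show "g x \<le> f y + h (x - y)" "g x \<le> h (x - (\<integral>y. y \<partial>\<nu>))"
    by (metis, metis add_0)
  show "convex_on UNIV g" "integrable \<mu> g" "integrable \<nu> f"
    using assms integrable_C_b[OF \<mu>, of g] integrable_C_b[OF \<nu>, of f]
    by (auto simp: feasible_def convex_functions_def)
  show "0 \<le> (\<integral>y. f y \<partial>\<nu>)"
    using assms convex_C_b_barycentre[OF \<nu> p, of f] by (simp add: feasible_def)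
qed

lemma C_b_diff_const:
  assumes "f \<in> convex_functions \<inter> C_b p"
  shows "(\<lambda>x. f x - k) \<in> convex_functions \<inter> C_b p"
proof -
  obtain C where C: "\<And>x. \<bar>f x\<bar> \<le> C * weight p x" using assms by (auto simp: C_b_iff)
  have "convex_on UNIV (\<lambda>x. f x + (- k))"
    using assms by (intro convex_on_add) (auto simp: convex_functions_def intro!: convex_on_const[THEN iffD2])
  moreover have "f x + (- k) \<le> (C + \<bar>k\<bar>) * weight p x" for x
  proof -
    have "\<bar>k\<bar> * 1 \<le> \<bar>k\<bar> * weight p x" by (intro mult_left_mono weight_ge_1) auto
    then show ?thesis using C[of x] by (simp add: algebra_simps)
  qed
  ultimately have "(\<lambda>x. f x + (- k)) \<in> convex_functions \<inter> C_b p" by (intro convex_C_bI[OF _ p])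
  then show ?thesis by simp
qed

text \<open>Subtracting the same constant from both functions keeps the constraint and, both
  measures having mass 1, the value.\<close>

lemma backward_value_feasible:
  assumes \<phi>: "\<phi> \<in> convex_functions \<inter> C_b p" and gt: "- \<infinity> < backward_value c \<mu> \<nu> (\<lambda>y. ereal (\<phi> y))"
  obtains g f where "feasible g f"
    "backward_value c \<mu> \<nu> (\<lambda>y. ereal (\<phi> y)) = ereal ((\<integral>x. g x \<partial>\<mu>) - (\<integral>y. f y \<partial>\<nu>))"
  using \<phi>
proof (cases rule: Q_inf_real_or_backward_value_minus_infinity)
  case 1
  then show ?thesis using gt by simp
next
  case (2 q)
  interpret M: prob_space \<mu> using \<mu> by (simp add: P_moment_def)
  interpret N: prob_space \<nu> by (rule prob_\<nu>)
  define k where "k = \<phi> (\<integral>y. y \<partial>\<nu>)"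
  have "q x \<le> \<phi> y + h (x - y)" for x y
    using Q_inf_le[of c "\<lambda>y. ereal (\<phi> y)" x y] by (simp add: 2 cost_def)
  then have "feasible (\<lambda>x. q x - k) (\<lambda>y. \<phi> y - k)"
    using C_b_diff_const[OF \<phi>, of k] C_b_diff_const[OF 2(1), of k] by (simp add: feasible_def k_def)
  moreover have "backward_value c \<mu> \<nu> (\<lambda>y. ereal (\<phi> y)) = ereal ((\<integral>x. q x - k \<partial>\<mu>) - (\<integral>y. \<phi> y - k \<partial>\<nu>))"
    using \<phi> 2(1) integrable_C_b[OF \<mu>, of q] integrable_C_b[OF \<nu>, of \<phi>]
    by (subst backward_value_real[OF _ _ 2(2)]) (auto simp: M.prob_space N.prob_space)
  ultimately show ?thesis by (rule that)
qed

lemma integrable_H: "integrable \<mu> (\<lambda>x. h (x - b))"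
proof (rule integrable_C_b[OF \<mu>])
  have "\<bar>h (x - b)\<bar> \<le> (K * 2 powr p * weight p b) * weight p x" for x
    using h_diff_le[of x b] h_nonneg[of "x - b"] by (simp add: algebra_simps)
  moreover have "continuous_on UNIV (\<lambda>x. h (x - b))"
    by (intro continuous_on_compose2[OF h_continuous] continuous_intros) auto
  ultimately show "(\<lambda>x. h (x - b)) \<in> C_b p" by (auto simp: C_b_iff)
qed

text \<open>Normalised pairs satisfy \<open>g x\<close> \<le> \<open>h (x - b)\<close>, with
  \<open>b\<close> the barycentre of \<nu>, and the integral of \<open>f\<close> is nonnegative,
  which bounds the value above. The zero potential bounds it below, as \<open>h\<close> is
  nonnegative.\<close>

lemma D_backward_finite:
  obtains D where "D_backward p c \<mu> \<nu> = ereal D"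
proof -
  let ?b = "\<integral>y. y \<partial>\<nu>"
  have "D_backward p c \<mu> \<nu> \<le> ereal (\<integral>x. h (x - ?b) \<partial>\<mu>)"
    unfolding D_backward_def
  proof (rule SUP_least)
    fix \<phi> :: "'a \<Rightarrow> real" assume \<phi>: "\<phi> \<in> convex_functions \<inter> C_b p"
    show "backward_value c \<mu> \<nu> (\<lambda>y. ereal (\<phi> y)) \<le> ereal (\<integral>x. h (x - ?b) \<partial>\<mu>)"
    proof (cases "backward_value c \<mu> \<nu> (\<lambda>y. ereal (\<phi> y)) = - \<infinity>")
      case False
      then have "- \<infinity> < backward_value c \<mu> \<nu> (\<lambda>y. ereal (\<phi> y))" by simp
      from backward_value_feasible[OF \<phi> this] obtain g f where gf: "feasible g f"
        "backward_value c \<mu> \<nu> (\<lambda>y. ereal (\<phi> y)) = ereal ((\<integral>x. g x \<partial>\<mu>) - (\<integral>y. f y \<partial>\<nu>))" by blast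
      have "(\<integral>x. g x \<partial>\<mu>) \<le> (\<integral>x. h (x - ?b) \<partial>\<mu>)"
        by (intro integral_mono feasibleD(2,5)[OF gf(1)] integrable_H)
      then show ?thesis using feasibleD(6)[OF gf(1)] by (simp add: gf(2))
    qed simp
  qed
  moreover have "0 \<le> D_backward p c \<mu> \<nu>"
  proof -
    let ?z = "\<lambda>y::'a. 0::real"
    have z: "?z \<in> convex_functions \<inter> C_b p"
      by (auto simp: convex_functions_def C_b_iff intro!: exI[of _ 0] convex_on_const[THEN iffD2])
    have "0 \<le> ext_integral \<mu> (Q_inf c (\<lambda>y. ereal (?z y)))"
    proof -
      have "ext_integral \<mu> (\<lambda>x. ereal 0) \<le> ext_integral \<mu> (Q_inf c (\<lambda>y. ereal (?z y)))"
        by (intro ext_integral_mono) (auto simp: Q_inf_def cost_def h_nonneg intro!: INF_greatest)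
      then show ?thesis by (simp add: ext_integral_ereal zero_ereal_def)
    qed
    then have "0 \<le> backward_value c \<mu> \<nu> (\<lambda>y. ereal (?z y))"
      by (simp add: backward_value_def ext_integral_ereal del: zero_ereal_def[symmetric])
    also have "\<dots> \<le> D_backward p c \<mu> \<nu>" unfolding D_backward_def by (rule SUP_upper[OF z])
    finally show ?thesis .
  qed
  ultimately show ?thesis by (cases "D_backward p c \<mu> \<nu>") (auto intro: that)
qed

lemma maximizing_sequence:
  assumes D: "D_backward p c \<mu> \<nu> = ereal D"
  obtains g f where "\<And>n. feasible (g n) (f n)"
    "\<And>n. D - 1 / real (Suc n) < (\<integral>x. g n x \<partial>\<mu>) - (\<integral>y. f n y \<partial>\<nu>)"
proof -
  have "\<exists>g f. feasible g f \<and> D - 1 / real (Suc n) < (\<integral>x. g x \<partial>\<mu>) - (\<integral>y. f y \<partial>\<nu>)" for n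
  proof -
    have "ereal (D - 1 / real (Suc n)) < D_backward p c \<mu> \<nu>" by (simp add: D)
    then obtain \<phi> where \<phi>: "\<phi> \<in> convex_functions \<inter> C_b p"
      "ereal (D - 1 / real (Suc n)) < backward_value c \<mu> \<nu> (\<lambda>y. ereal (\<phi> y))"
      unfolding D_backward_def less_SUP_iff by blast
    then have "- \<infinity> < backward_value c \<mu> \<nu> (\<lambda>y. ereal (\<phi> y))" by auto
    from backward_value_feasible[OF \<phi>(1) this] obtain g f where gf: "feasible g f"
      "backward_value c \<mu> \<nu> (\<lambda>y. ereal (\<phi> y)) = ereal ((\<integral>x. g x \<partial>\<mu>) - (\<integral>y. f y \<partial>\<nu>))" by blast
    then have "D - 1 / real (Suc n) < (\<integral>x. g x \<partial>\<mu>) - (\<integral>y. f y \<partial>\<nu>)"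
      using \<phi>(2) by simp
    with gf(1) show ?thesis by blast
  qed
  then show ?thesis using that by metis
qed

lemma ball_positive_measure:
  obtains R :: nat where "0 < measure \<mu> (cball 0 (real R))"
proof -
  interpret prob_space \<mu> using \<mu> by (simp add: P_moment_def)
  have sets: "sets \<mu> = sets borel" using \<mu> by (simp add: P_moment_def)
  have "(\<Union>n. cball (0::'a) (real n)) = UNIV"
    by (auto simp: real_arch_simple)
  moreover have "space \<mu> = UNIV" using sets_eq_imp_space_eq[OF sets] by simp
  ultimately have "emeasure \<mu> (\<Union>n. cball (0::'a) (real n)) = 1" using emeasure_space_1 by simp
  then obtain n where "emeasure \<mu> (cball (0::'a) (real n)) \<noteq> 0"
    using emeasure_UN_eq_0[of \<mu> "\<lambda>n. cball (0::'a) (real n)"] by (auto simp: sets image_subset_iff)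
  then show ?thesis
    by (intro that[of n]) (simp add: emeasure_eq_measure zero_less_measure_iff)
qed

text \<open>A lower bound on \<open>\<integral>g d\<mu>\<close> produces points of a fixed ball where \<open>g\<close> is not too negative;
  reflecting at such a point turns the common upper bound of feasible \<open>g\<close> into a lower one.\<close>
lemma feasible_bounds:
  obtains L C' where "\<And>g f x. feasible g f \<Longrightarrow> A \<le> (\<integral>x. g x \<partial>\<mu>) \<Longrightarrow> \<bar>g x\<bar> \<le> L x"
    "\<And>g f y. feasible g f \<Longrightarrow> A \<le> (\<integral>x. g x \<partial>\<mu>) \<Longrightarrow> - C' * weight p y \<le> f y"
proof -
  let ?b = "\<integral>y. y \<partial>\<nu>"
  define H where "H x = h (x - ?b)" for x
  interpret prob_space \<mu> using \<mu> by (simp add: P_moment_def)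
  obtain R :: nat where R: "0 < measure \<mu> (cball 0 (real R))" using ball_positive_measure .
  define m where "m = measure \<mu> (cball 0 (real R))"
  \<comment> \<open>With this choice \<open>C * m\<close> exceeds the sum of the absolute values of
    \<open>A\<close> and of the integral of \<open>H\<close> by \<open>m\<close>. If
    \<open>g\<close> were below \<open>- C\<close> on the whole ball, its integral would thus fall
    below \<open>A\<close>.\<close>
  define C where "C = (\<bar>A\<bar> + \<bar>\<integral>x. H x \<partial>\<mu>\<bar>) / m + 1"
  have m: "0 < m" using R by (simp add: m_def)
  have C: "0 < C" using m by (auto simp: C_def intro!: add_nonneg_pos)
  have pt: "\<exists>z. norm z \<le> real R \<and> - C \<le> g z" if gf: "feasible g f" and A: "A \<le> (\<integral>x. g x \<partial>\<mu>)" for g f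
  proof (rule ccontr)
    assume "\<not> ?thesis"
    then have neg: "g z < - C" if "norm z \<le> real R" for z using that by force
    have sets: "cball 0 (real R) \<in> sets \<mu>" using \<mu> by (simp add: P_moment_def)
    have I: "integrable \<mu> (\<lambda>x. C * indicator (cball 0 (real R)) x)"
      using sets by (intro integrable_mult_right integrable_real_indicator) (auto simp: less_top[symmetric])
    have IH: "integrable \<mu> H" unfolding H_def by (rule integrable_H)
    have "A \<le> (\<integral>x. g x \<partial>\<mu>)" by (rule A)
    also have "\<dots> \<le> (\<integral>x. H x - C * indicator (cball 0 (real R)) x \<partial>\<mu>)"
    proof (rule integral_mono)
      show "g x \<le> H x - C * indicator (cball 0 (real R)) x" for x
        using neg[of x] feasibleD(5)[OF gf, of x] h_nonneg[of "x - ?b"]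
        by (cases "norm x \<le> real R") (auto simp: H_def indicator_def)
    qed (use I IH feasibleD(2)[OF gf] in auto)
    also have "\<dots> = (\<integral>x. H x \<partial>\<mu>) - C * m"
      using I IH sets by (simp add: m_def)
    also have "C * m = \<bar>A\<bar> + \<bar>\<integral>x. H x \<partial>\<mu>\<bar> + m"
      using m by (simp add: C_def field_simps)
    finally show False using m by linarith
  qed
  have K: "0 \<le> K"
  proof -
    have "0 \<le> K * weight p (0::'a)" using h_nonneg h_le order_trans by blast
    then show ?thesis using weight_ge_1[of p "0::'a"] by (simp add: zero_le_mult_iff)
  qed
  have weight_le: "weight p z \<le> 1 + r powr p" if "norm z \<le> r" for r and z :: 'a
    using that p unfolding weight_def by (intro add_left_mono powr_mono2) auto
  have h_le': "h (z - y) \<le> K * 2 powr p * (1 + r powr p) * weight p y" if "norm z \<le> r" for r z y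
  proof -
    have "K * 2 powr p * weight p z * weight p y \<le> K * 2 powr p * (1 + r powr p) * weight p y"
      using K weight_le[OF that] weight_ge_1[of p y] by (intro mult_right_mono mult_left_mono) auto
    then show ?thesis using h_diff_le[of z y] by simp
  qed
  \<comment> \<open>The lower bound on \<open>g x\<close> is
    \<open>2 * g z - g (2 *\<^sub>R z - x)\<close>, which explains \<open>2 * C\<close> and the
    radius \<open>2 * real R\<close>.\<close>
  define L where "L x = H x + 2 * C + K * 2 powr p * (1 + (2 * real R) powr p) * weight p (x + ?b)" for x
  define C' where "C' = C + K * 2 powr p * (1 + real R powr p)"
  show ?thesis
  proof (rule that)
    fix g f x assume gf: "feasible g f" and A: "A \<le> (\<integral>x. g x \<partial>\<mu>)"
    obtain z where z: "norm z \<le> real R" "- C \<le> g z" using pt[OF gf A] by blast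
    have zz: "z = (1 - 1/2) *\<^sub>R x + (1/2) *\<^sub>R (2 *\<^sub>R z - x)" by (simp add: algebra_simps)
    have "g ((1 - 1/2) *\<^sub>R x + (1/2) *\<^sub>R (2 *\<^sub>R z - x)) \<le> (1 - 1/2) * g x + (1/2) * g (2 *\<^sub>R z - x)"
      by (intro convex_onD[OF feasibleD(1)[OF gf]]) auto
    then have "g z \<le> (1/2) * g x + (1/2) * g (2 *\<^sub>R z - x)"
      unfolding zz[symmetric] by simp
    moreover have "g (2 *\<^sub>R z - x) \<le> h (2 *\<^sub>R z - (x + ?b))"
      using feasibleD(5)[OF gf, of "2 *\<^sub>R z - x"] by (simp add: algebra_simps)
    moreover have "\<dots> \<le> K * 2 powr p * (1 + (2 * real R) powr p) * weight p (x + ?b)"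
      using z by (intro h_le') auto
    moreover have "0 \<le> K * 2 powr p * (1 + (2 * real R) powr p) * weight p (x + ?b)"
      using K weight_ge_1[of p "x + ?b"] by (intro mult_nonneg_nonneg) auto
    moreover have "g x \<le> H x" using feasibleD(5)[OF gf, of x] by (simp add: H_def)
    moreover have "0 \<le> H x" by (simp add: H_def h_nonneg)
    ultimately show "\<bar>g x\<bar> \<le> L x" unfolding L_def using z(2) C by (intro abs_leI) linarith+
  next
    fix g f y assume gf: "feasible g f" and A: "A \<le> (\<integral>x. g x \<partial>\<mu>)"
    obtain z where z: "norm z \<le> real R" "- C \<le> g z" using pt[OF gf A] by blast
    have "g z \<le> f y + h (z - y)" by (rule feasibleD(4)[OF gf])
    moreover have "h (z - y) \<le> K * 2 powr p * (1 + real R powr p) * weight p y" by (rule h_le'[OF z(1)])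
    moreover have "C * 1 \<le> C * weight p y" using C by (intro mult_left_mono weight_ge_1) auto
    ultimately show "- C' * weight p y \<le> f y" using z(2) by (simp add: C'_def algebra_simps)
  qed
qed


section \<open>Existence of an optimal forward potential\<close>

lemma exists_forward_optimal:
  obtains \<psi> where "\<psi> \<in> convex_functions \<inter> C_b p" "Q_sup c (\<lambda>x. ereal (\<psi> x)) \<in> convex_L1 \<nu>"
    "D_forward p c \<mu> \<nu> \<le> forward_value c \<mu> \<nu> (\<lambda>x. ereal (\<psi> x))"
proof -
  obtain D where D: "D_backward p c \<mu> \<nu> = ereal D" using D_backward_finite .
  obtain g0 f0 where gf0: "\<And>n. feasible (g0 n) (f0 n)"
    "\<And>n. D - 1 / real (Suc n) < (\<integral>x. g0 n x \<partial>\<mu>) - (\<integral>y. f0 n y \<partial>\<nu>)"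
    using maximizing_sequence[OF D] by blast
  have A0: "D - 1 \<le> (\<integral>x. g0 n x \<partial>\<mu>)" for n
  proof -
    have "1 / real (Suc n) \<le> 1" by simp
    then show ?thesis using gf0(2)[of n] feasibleD(6)[OF gf0(1)[of n]] by linarith
  qed
  obtain L C' where L: "\<And>n x. \<bar>g0 n x\<bar> \<le> L x" and C': "\<And>n y. - C' * weight p y \<le> f0 n y"
    using feasible_bounds[of "D - 1"] gf0(1) A0 by metis
  obtain S :: "'a set" where S: "countable S" "\<And>X. open X \<Longrightarrow> X \<noteq> {} \<Longrightarrow> \<exists>d\<in>S. d \<in> X"
    by (rule countable_dense_setE) blast
  obtain r where r: "strict_mono r" "\<And>x. x \<in> S \<Longrightarrow> convergent (\<lambda>n. g0 (r n) x)"
    using pointwise_bounded_convergent_subsequence[of S g0 L] S(1) L by blast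
  define g where "g n = g0 (r n)" for n
  define f where "f n = f0 (r n)" for n
  have gf: "feasible (g n) (f n)" for n by (simp add: g_def f_def gf0)
  have gL: "\<bar>g n x\<bar> \<le> L x" for n x by (simp add: g_def L)
  have fC': "- C' * weight p y \<le> f n y" for n y unfolding f_def by (rule C')
  let ?b = "\<integral>y. y \<partial>\<nu>"

  define \<psi> where "\<psi> x = real_of_ereal (limsup (\<lambda>n. ereal (g n x)))" for x
  have \<psi>: "limsup (\<lambda>n. ereal (g n x)) = ereal (\<psi> x)" for x
  proof -
    have "limsup (\<lambda>n. ereal (g n x)) \<le> ereal (L x)"
      using gL[of _ x] by (intro Limsup_bounded always_eventually) (auto simp: abs_le_iff)
    moreover have "ereal (- L x) \<le> liminf (\<lambda>n. ereal (g n x))"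
    proof (intro Liminf_bounded always_eventually allI)
      fix n show "ereal (- L x) \<le> ereal (g n x)" using gL[of n x] by simp
    qed
    then have "ereal (- L x) \<le> limsup (\<lambda>n. ereal (g n x))"
      using Liminf_le_Limsup[of sequentially "\<lambda>n. ereal (g n x)"] by (auto intro: order_trans)
    ultimately show ?thesis unfolding \<psi>_def by (cases "limsup (\<lambda>n. ereal (g n x))") auto
  qed
  have less: "eventually (\<lambda>n. g n x < \<psi> x + e) sequentially" if "0 < e" for x e
    using Limsup_lessD[of sequentially "\<lambda>n. ereal (g n x)" "ereal (\<psi> x + e)"] that by (simp add: \<psi>)
  have leI: "\<psi> x \<le> k" if "eventually (\<lambda>n. g n x \<le> k) sequentially" for x k
    using Limsup_bounded[of "\<lambda>n. ereal (g n x)" "ereal k" sequentially] that by (simp add: \<psi>)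
  have \<psi>_H: "\<psi> x \<le> h (x - ?b)" for x
    by (intro leI always_eventually allI feasibleD(5)[OF gf])
  have \<psi>_convex: "convex_on UNIV \<psi>"
  proof (rule convex_onI)
    fix t x y :: "_" assume t: "0 < t" "t < (1::real)"
    show "\<psi> ((1 - t) *\<^sub>R x + t *\<^sub>R y) \<le> (1 - t) * \<psi> x + t * \<psi> y"
    proof (rule field_le_epsilon)
      fix e :: real assume "0 < e"
      have "eventually (\<lambda>n. g n ((1 - t) *\<^sub>R x + t *\<^sub>R y) \<le> (1 - t) * \<psi> x + t * \<psi> y + e) sequentially"
        using less[OF \<open>0 < e\<close>, of x] less[OF \<open>0 < e\<close>, of y]
      proof eventually_elim
        case (elim n)
        have "g n ((1 - t) *\<^sub>R x + t *\<^sub>R y) \<le> (1 - t) * g n x + t * g n y"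
          using t by (intro convex_onD[OF feasibleD(1)[OF gf]]) auto
        also have "\<dots> \<le> (1 - t) * (\<psi> x + e) + t * (\<psi> y + e)"
          using t elim by (intro add_mono mult_left_mono) auto
        finally show ?case by (simp add: algebra_simps)
      qed
      then show "\<psi> ((1 - t) *\<^sub>R x + t *\<^sub>R y) \<le> (1 - t) * \<psi> x + t * \<psi> y + e" by (rule leI)
    qed
  qed simp
  have \<psi>C: "\<psi> \<in> convex_functions \<inter> C_b p"
  proof (rule convex_C_bI[OF \<psi>_convex p])
    show "\<psi> x \<le> (K * 2 powr p * weight p ?b) * weight p x" for x
      using \<psi>_H[of x] h_diff_le[of x ?b] by (simp add: algebra_simps)
  qed
  have \<psi>I: "integrable \<mu> \<psi>" using \<psi>C by (intro integrable_C_b[OF \<mu>]) auto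

  define \<phi> where "\<phi> = Q_sup c (\<lambda>x. ereal (\<psi> x))"
  \<comment> \<open>A strict lower bound on the supremum is attained on an open set of points, hence
    at some \<open>d\<close> in \<open>S\<close>. There \<open>g n\<close> truly converges, so the
    constraint passes the bound to \<open>f n\<close> for all large \<open>n\<close>.\<close>
  have lower: "eventually (\<lambda>n. s < f n y) sequentially" if s: "ereal s < \<phi> y" for s y
  proof -
    obtain x where x: "s < \<psi> x - h (x - y)"
      using s by (auto simp: \<phi>_def Q_sup_def less_SUP_iff cost_def)
    have "continuous_on UNIV \<psi>" using \<psi>C by (simp add: C_b_iff)
    then have "open {x. s < \<psi> x - h (x - y)}"
      by (intro open_Collect_less continuous_intros continuous_on_compose2[OF h_continuous]) auto
    then obtain d where d: "d \<in> S" "s < \<psi> d - h (d - y)"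
      using S(2)[of "{x. s < \<psi> x - h (x - y)}"] x by blast
    obtain l where l: "(\<lambda>n. g n d) \<longlonglongrightarrow> l"
      using r(2)[OF d(1)] by (auto simp: convergent_def g_def)
    then have "(\<lambda>n. ereal (g n d)) \<longlonglongrightarrow> ereal l" by simp
    then have "l = \<psi> d"
      using lim_imp_Limsup[of sequentially "\<lambda>n. ereal (g n d)" "ereal l"] by (simp add: \<psi>)
    then have "eventually (\<lambda>n. s + h (d - y) < g n d) sequentially"
      using d(2) by (intro order_tendstoD(1)[OF l]) simp
    then show ?thesis
    proof eventually_elim
      case (elim n)
      then show ?case using feasibleD(4)[OF gf, of n d y] by linarith
    qed
  qed

  \<comment> \<open>Near-optimality bounds the integrals of \<open>f n\<close> above, since those of
    \<open>g n\<close> are bounded by that of \<open>h (x - ?b)\<close>.\<close>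
  define B where "B = (\<integral>x. h (x - ?b) \<partial>\<mu>) - D + 1"
  have fB: "(\<integral>y. f n y \<partial>\<nu>) \<le> B" for n
  proof -
    have "1 / real (Suc (r n)) \<le> 1" by simp
    then have "D - 1 < (\<integral>x. g n x \<partial>\<mu>) - (\<integral>y. f n y \<partial>\<nu>)"
      using gf0(2)[of "r n"] unfolding g_def f_def by linarith
    moreover have "(\<integral>x. g n x \<partial>\<mu>) \<le> (\<integral>x. h (x - ?b) \<partial>\<mu>)"
      by (intro integral_mono feasibleD(2,5)[OF gf] integrable_H)
    ultimately show ?thesis by (simp add: B_def)
  qed
  define W where "W y = \<bar>C'\<bar> * weight p y" for y :: 'a
  have W: "integrable \<nu> W" "0 \<le> W y" "- W y \<le> f n y" for y n
  proof -
    show "integrable \<nu> W" unfolding W_def using integrable_weight[OF \<nu>] by simp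
    have "C' * weight p y \<le> \<bar>C'\<bar> * weight p y"
      using weight_ge_1[of p y] by (intro mult_right_mono) auto
    then show "- W y \<le> f n y" using fC'[of y n] by (simp add: W_def)
    show "0 \<le> W y" unfolding W_def using weight_ge_1[of p y] by simp
  qed
  \<comment> \<open>Adding \<open>W\<close> makes the functions nonnegative, as Fatou's lemma for
    nonnegative integrals requires; since \<open>W\<close> is nonnegative, their lower limit still
    dominates the positive part of \<open>\<phi>\<close>.\<close>
  have "(\<integral>\<^sup>+ y. e2ennreal (\<phi> y) \<partial>\<nu>) \<le> (\<integral>\<^sup>+ y. liminf (\<lambda>n. ennreal (f n y + W y)) \<partial>\<nu>)"
  proof (rule nn_integral_mono)
    fix y
    show "e2ennreal (\<phi> y) \<le> liminf (\<lambda>n. ennreal (f n y + W y))"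
      unfolding le_Liminf_iff
    proof (intro allI impI)
      fix a assume a: "a < e2ennreal (\<phi> y)"
      then obtain s where s: "0 \<le> s" "a = ennreal s" by (cases a) auto
      have "ereal s < \<phi> y"
      proof (rule ccontr)
        assume "\<not> ?thesis"
        then have "e2ennreal (\<phi> y) \<le> e2ennreal (ereal s)" by (intro e2ennreal_mono) simp
        then show False using a s by simp
      qed
      then have "eventually (\<lambda>n. s < f n y) sequentially" by (rule lower)
      then show "eventually (\<lambda>n. a < ennreal (f n y + W y)) sequentially"
      proof eventually_elim
        case (elim n)
        then have "s < f n y + W y" using W(2)[of y] by linarith
        then show ?case unfolding s(2) using s(1) by (subst ennreal_less_iff)
      qed
    qed
  qed
  also have "\<dots> \<le> liminf (\<lambda>n. \<integral>\<^sup>+ y. ennreal (f n y + W y) \<partial>\<nu>)"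
    using feasibleD(3)[OF gf] W(1) by (intro nn_integral_liminf) auto
  also have "\<dots> \<le> ennreal (B + (\<integral>y. W y \<partial>\<nu>))"
  proof -
    have "(\<integral>\<^sup>+ y. ennreal (f n y + W y) \<partial>\<nu>) \<le> ennreal (B + (\<integral>y. W y \<partial>\<nu>))" for n
    proof -
      have "0 \<le> f n y + W y" for y using W(3)[of y n] by linarith
      then have "(\<integral>\<^sup>+ y. ennreal (f n y + W y) \<partial>\<nu>) = ennreal (\<integral>y. f n y + W y \<partial>\<nu>)"
        using feasibleD(3)[OF gf] W(1) by (intro nn_integral_eq_integral) auto
      then show ?thesis using fB[of n] feasibleD(3)[OF gf] W(1) by (simp add: ennreal_leI)
    qed
    then have "limsup (\<lambda>n. \<integral>\<^sup>+ y. ennreal (f n y + W y) \<partial>\<nu>) \<le> ennreal (B + (\<integral>y. W y \<partial>\<nu>))"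
      by (intro Limsup_bounded always_eventually) auto
    then show ?thesis
      using Liminf_le_Limsup[of sequentially "\<lambda>n. \<integral>\<^sup>+ y. ennreal (f n y + W y) \<partial>\<nu>"] by (auto intro: order_trans)
  qed
  also have "\<dots> < \<infinity>" by simp
  finally have fin: "(\<integral>\<^sup>+ y. e2ennreal (\<phi> y) \<partial>\<nu>) < \<infinity>" .
  have "ext_integral \<nu> \<phi> \<noteq> \<infinity>"
  proof -
    have "ext_integral \<nu> \<phi> \<le> enn2ereal (\<integral>\<^sup>+ y. e2ennreal (\<phi> y) \<partial>\<nu>) - 0"
      unfolding ext_integral_def by (intro ereal_minus_mono) auto
    also have "\<dots> < \<infinity>" using fin by (cases "\<integral>\<^sup>+ y. e2ennreal (\<phi> y) \<partial>\<nu>") (auto simp: enn2ereal_ennreal)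
    finally show ?thesis by simp
  qed
  then have \<phi>L1: "\<phi> \<in> convex_L1 \<nu>" unfolding \<phi>_def by (rule Q_sup_convex_L1[OF \<psi>C])
  then have \<phi>m: "\<phi> \<in> borel_measurable \<nu>" "(\<integral>\<^sup>+ y. e2ennreal \<bar>\<phi> y\<bar> \<partial>\<nu>) < \<infinity>" by (auto simp: convex_L1_iff)
  let ?I = "(\<integral>x. \<psi> x \<partial>\<mu>) - (\<integral>y. real_of_ereal (\<phi> y) \<partial>\<nu>)"

  \<comment> \<open>The tolerance is split evenly between the two applications of Fatou's lemma and
    the defect of the maximizing sequence.\<close>
  have "D \<le> ?I"
  proof (rule field_le_epsilon)
    fix e :: real assume "0 < e"
    then have e: "0 < e / 3" by simp
    have "eventually (\<lambda>n. (\<integral>x. - \<psi> x \<partial>\<mu>) - e / 3 < (\<integral>x. - g n x \<partial>\<mu>)) sequentially"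
    proof (rule Fatou_eventually)
      show "integrable \<mu> (\<lambda>x. - g n x)" for n using feasibleD(2)[OF gf] by simp
      show "integrable \<mu> (\<lambda>x. - \<psi> x)" using \<psi>I by simp
      show "integrable \<mu> (\<lambda>x. - h (x - ?b))" using integrable_H by simp
      show "- h (x - ?b) \<le> - g n x" for n x using feasibleD(5)[OF gf] by simp
      show "AE x in \<mu>. \<forall>e>0. eventually (\<lambda>n. - \<psi> x - e < - g n x) sequentially"
      proof (intro AE_I2 allI impI)
        fix x and e :: real assume "0 < e"
        from less[OF this, of x] show "eventually (\<lambda>n. - \<psi> x - e < - g n x) sequentially"
          by eventually_elim simp
      qed
    qed (rule e)
    moreover have "eventually (\<lambda>n. (\<integral>y. real_of_ereal (\<phi> y) \<partial>\<nu>) - e / 3 < (\<integral>y. f n y \<partial>\<nu>)) sequentially"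
    proof (rule Fatou_eventually)
      show "integrable \<nu> (f n)" for n by (rule feasibleD(3)[OF gf])
      show "integrable \<nu> (\<lambda>y. real_of_ereal (\<phi> y))" by (rule ext_integral_real_of_ereal(1)[OF \<phi>m])
      show "integrable \<nu> (\<lambda>y. - W y)" using W(1) by simp
      show "- W y \<le> f n y" for n y by (rule W(3))
      show "AE y in \<nu>. \<forall>e>0. eventually (\<lambda>n. real_of_ereal (\<phi> y) - e < f n y) sequentially"
        using ext_integral_real_of_ereal(2)[OF \<phi>m]
      proof (eventually_elim, intro allI impI)
        fix y and e :: real assume y: "\<phi> y = ereal (real_of_ereal (\<phi> y))" and e: "0 < e"
        show "eventually (\<lambda>n. real_of_ereal (\<phi> y) - e < f n y) sequentially"
          by (rule lower, subst y) (use e in simp)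
      qed
    qed (rule e)
    moreover have "eventually (\<lambda>n. 1 / real (Suc n) < e / 3) sequentially"
      using order_tendstoD(2)[OF LIMSEQ_inverse_real_of_nat e] by (simp add: inverse_eq_divide)
    ultimately have "eventually (\<lambda>n. D \<le> ?I + e) sequentially"
    proof eventually_elim
      case (elim n)
      have "1 / real (Suc (r n)) \<le> 1 / real (Suc n)"
        using seq_suble[OF r(1), of n] by (simp add: frac_le)
      then show ?case using elim gf0(2)[of "r n"] by (simp add: g_def f_def)
    qed
    then show "D \<le> ?I + e" by simp
  qed
  then have "D_forward p c \<mu> \<nu> \<le> forward_value c \<mu> \<nu> (\<lambda>x. ereal (\<psi> x))"
    using \<psi>C \<phi>L1 D D_backward_eq_D_forward by (simp add: forward_value_real \<phi>_def)
  with \<psi>C \<phi>L1 show ?thesis unfolding \<phi>_def by (rule that)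
qed

lemma conjugate_pair_biconjugate:
  assumes "conjugate_pair \<psi> \<phi>"
  shows "\<phi> y = Q_sup c (Q_inf c \<phi>) y"
    and "ereal (\<psi> x) = Q_inf c (Q_sup c (\<lambda>x. ereal (\<psi> x))) x"
proof -
  have "Q_inf c \<phi> = (\<lambda>x. ereal (\<psi> x))" using conjugate_pairD(3)[OF assms] by blast
  then show "\<phi> y = Q_sup c (Q_inf c \<phi>) y" by (simp add: conjugate_pairD(4)[OF assms])
  show "ereal (\<psi> x) = Q_inf c (Q_sup c (\<lambda>x. ereal (\<psi> x))) x"
    by (simp add: conjugate_pairD(3,4)[OF assms])
qed

end

section \<open>From the standing assumption to the two optimal pairs\<close>

text \<open>The growth hypothesis controls \<open>h\<close> only for norms at least
  \<open>a\<close>; on the remaining ball \<open>h\<close> is bounded by continuity, and the sum of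
  the two constants serves everywhere.\<close>

lemma standing_cost_imp_convex_cost:
  assumes "standing_cost p h" "p \<ge> 1" "\<mu> \<in> P_moment p" "\<nu> \<in> P_moment p"
  obtains K where "convex_cost h p K \<mu> \<nu>"
proof -
  have sc: "strictly_convex h" and nn: "\<And>z. 0 \<le> h z"
    using assms(1) by (auto simp: standing_cost_def)
  obtain a where a: "0 < a" "bdd_above ((\<lambda>z. h z / norm z powr p) ` {z. a \<le> norm z})"
    using assms(1) unfolding standing_cost_def by blast
  then obtain B where B: "\<And>z. a \<le> norm z \<Longrightarrow> h z / norm z powr p \<le> B"
    unfolding bdd_above_def by blast
  have conv: "convex_on UNIV h"
  proof (rule convex_onI)
    fix t x y :: "_" assume t: "0 < t" "t < (1::real)"
    show "h ((1 - t) *\<^sub>R x + t *\<^sub>R y) \<le> (1 - t) * h x + t * h y"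
    proof (cases "x = y")
      case True
      have "(1 - t) *\<^sub>R y + t *\<^sub>R y = y" by (simp add: algebra_simps)
      moreover have "(1 - t) * h y + t * h y = h y" by (simp add: algebra_simps)
      ultimately show ?thesis using True by simp
    next
      case False
      then show ?thesis using sc t unfolding strictly_convex_def by (meson less_imp_le)
    qed
  qed simp
  then have "continuous_on UNIV h" by (intro convex_on_continuous) auto
  then have "compact (h ` cball 0 a)"
    by (intro compact_continuous_image) (auto intro: continuous_on_subset)
  then obtain E where E: "\<And>z. norm z \<le> a \<Longrightarrow> h z \<le> E"
    using compact_imp_bounded[THEN bounded_imp_bdd_above] unfolding bdd_above_def by fastforce
  have "h z \<le> (\<bar>B\<bar> + \<bar>E\<bar>) * weight p z" for z
  proof (cases "norm z \<le> a")
    case True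
    have "\<bar>E\<bar> * 1 \<le> \<bar>E\<bar> * weight p z"
      by (intro mult_left_mono weight_ge_1) auto
    moreover have "0 \<le> \<bar>B\<bar> * weight p z"
      using weight_ge_1[of p z] by simp
    ultimately show ?thesis using E[OF True] by (simp add: algebra_simps)
  next
    case False
    then have pos: "0 < norm z powr p" using a(1) by (auto simp: powr_gt_zero)
    then have "h z \<le> B * norm z powr p"
      using B[of z] False by (simp add: pos_divide_le_eq)
    also have "\<dots> \<le> (\<bar>B\<bar> + \<bar>E\<bar>) * weight p z"
      using pos by (intro mult_mono) (auto simp: weight_def)
    finally show ?thesis .
  qed
  then have "convex_cost h p (\<bar>B\<bar> + \<bar>E\<bar>) \<mu> \<nu>"
    using assms conv nn by unfold_locales
  then show ?thesis by (rule that)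
qed

theorem theorem6:
  fixes h :: "'a::euclidean_space \<Rightarrow> real" and p :: real and \<mu> \<nu> :: "'a measure"
  assumes "p \<ge> 1"
    and "\<mu> \<in> P_moment p" and "\<nu> \<in> P_moment p"
    and "standing_cost p h"
  shows
    "(\<exists>\<psi> \<phi>. (\<psi>, \<phi>) \<in> S_class p \<nu> \<and> optimal_backward_pair p (cost h) \<mu> \<nu> \<psi> \<phi> \<and>
        (AE y in \<nu>. \<phi> y = Q_sup (cost h) (Q_inf (cost h) \<phi>) y))
     \<and>
     (\<exists>\<psi> \<phi>. (\<psi>, \<phi>) \<in> S_class p \<nu> \<and> optimal_forward_pair p (cost h) \<mu> \<nu> \<psi> \<phi> \<and>
        (AE x in \<mu>. ereal (\<psi> x) = Q_inf (cost h) (Q_sup (cost h) (\<lambda>x. ereal (\<psi> x))) x))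
     \<and>
     (\<forall>\<psi> \<phi>. (\<psi>, \<phi>) \<in> S_class p \<nu> \<longrightarrow>
        optimal_backward_pair p (cost h) \<mu> \<nu> \<psi> \<phi> \<or>
        optimal_forward_pair p (cost h) \<mu> \<nu> \<psi> \<phi> \<longrightarrow>
        (\<exists>\<psi>' \<phi>'. (\<psi>', \<phi>') \<in> S_class p \<nu> \<and>
           (AE x in \<mu>. \<psi>' x = \<psi> x) \<and> (AE y in \<nu>. \<phi>' y = \<phi> y) \<and>
           optimal_backward_pair p (cost h) \<mu> \<nu> \<psi>' \<phi>' \<and>
           optimal_forward_pair p (cost h) \<mu> \<nu> \<psi>' \<phi>' \<and>
           (\<forall>y. \<phi>' y = Q_sup (cost h) (\<lambda>x. ereal (\<psi>' x)) y) \<and>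
           (\<forall>x. ereal (\<psi>' x) = Q_inf (cost h) \<phi>' x)))"
proof -
  obtain K where "convex_cost h p K \<mu> \<nu>"
    using standing_cost_imp_convex_cost[OF assms(4,1,2,3)] .
  then interpret convex_cost h p K \<mu> \<nu> .
  obtain \<psi>0 where \<psi>0: "\<psi>0 \<in> convex_functions \<inter> C_b p" "Q_sup c (\<lambda>x. ereal (\<psi>0 x)) \<in> convex_L1 \<nu>"
    "D_forward p c \<mu> \<nu> \<le> forward_value c \<mu> \<nu> (\<lambda>x. ereal (\<psi>0 x))"
    using exists_forward_optimal .
  obtain \<psi> \<phi> where cp: "conjugate_pair \<psi> \<phi>" "D_forward p c \<mu> \<nu> \<le> forward_value c \<mu> \<nu> (\<lambda>x. ereal (\<psi> x))"
    using forward_optimal_imp_conjugate[OF \<psi>0] by blast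
  have S: "(\<psi>, \<phi>) \<in> S_class p \<nu>" using cp(1) unfolding conjugate_pair_def by blast
  have "AE y in \<nu>. \<phi> y = Q_sup c (Q_inf c \<phi>) y"
    by (intro AE_I2 conjugate_pair_biconjugate[OF cp(1)])
  moreover have "AE x in \<mu>. ereal (\<psi> x) = Q_inf c (Q_sup c (\<lambda>x. ereal (\<psi> x))) x"
    by (intro AE_I2 conjugate_pair_biconjugate[OF cp(1)])
  moreover have "\<exists>\<psi>' \<phi>'. (\<psi>', \<phi>') \<in> S_class p \<nu> \<and>
           (AE x in \<mu>. \<psi>' x = \<psi> x) \<and> (AE y in \<nu>. \<phi>' y = \<phi> y) \<and>
           optimal_backward_pair p c \<mu> \<nu> \<psi>' \<phi>' \<and>
           optimal_forward_pair p c \<mu> \<nu> \<psi>' \<phi>' \<and>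
           (\<forall>y. \<phi>' y = Q_sup c (\<lambda>x. ereal (\<psi>' x)) y) \<and>
           (\<forall>x. ereal (\<psi>' x) = Q_inf c \<phi>' x)"
    if S: "(\<psi>, \<phi>) \<in> S_class p \<nu>"
      and opt: "optimal_backward_pair p c \<mu> \<nu> \<psi> \<phi> \<or> optimal_forward_pair p c \<mu> \<nu> \<psi> \<phi>" for \<psi> \<phi>
  proof -
    have \<psi>: "\<psi> \<in> convex_functions \<inter> C_b p" and \<phi>: "\<phi> \<in> convex_L1 \<nu>" using S by (auto simp: S_class_def)
    \<comment> \<open>Optimality for either problem leads to a conjugate pair that is forward
      optimal and changes at most one of the functions, on a null set; such a pair is optimal for
      both problems.\<close>
    have "\<exists>\<psi>' \<phi>'. conjugate_pair \<psi>' \<phi>' \<and> (AE x in \<mu>. \<psi>' x = \<psi> x) \<and> (AE y in \<nu>. \<phi>' y = \<phi> y) \<and>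
      D_forward p c \<mu> \<nu> \<le> forward_value c \<mu> \<nu> (\<lambda>x. ereal (\<psi>' x))"
      using opt
    proof
      assume b: "optimal_backward_pair p c \<mu> \<nu> \<psi> \<phi>"
      then have q: "\<And>x. ereal (\<psi> x) = Q_inf c \<phi> x" and v: "D_backward p c \<mu> \<nu> \<le> backward_value c \<mu> \<nu> \<phi>"
        unfolding optimal_backward_pair_def by (blast, metis order_refl)
      have "AE x in \<mu>. \<psi> x = \<psi> x" by simp
      with backward_optimal_imp_conjugate[OF \<psi> q \<phi> v] show ?thesis by blast
    next
      assume f: "optimal_forward_pair p c \<mu> \<nu> \<psi> \<phi>"
      then have q: "\<phi> = Q_sup c (\<lambda>x. ereal (\<psi> x))"
        and v: "D_forward p c \<mu> \<nu> \<le> forward_value c \<mu> \<nu> (\<lambda>x. ereal (\<psi> x))"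
        unfolding optimal_forward_pair_def by (blast, metis order_refl)
      have "AE y in \<nu>. \<phi> y = \<phi> y" by simp
      with forward_optimal_imp_conjugate[OF \<psi> \<phi>[unfolded q] v] show ?thesis
        unfolding q[symmetric] by blast
    qed
    then obtain \<psi>' \<phi>' where *: "conjugate_pair \<psi>' \<phi>'" "AE x in \<mu>. \<psi>' x = \<psi> x" "AE y in \<nu>. \<phi>' y = \<phi> y"
      "D_forward p c \<mu> \<nu> \<le> forward_value c \<mu> \<nu> (\<lambda>x. ereal (\<psi>' x))" by blast
    from conjugate_pair_optimal[OF *(1,4)] *(1-3) show ?thesis
      unfolding conjugate_pair_def by blast
  qed
  ultimately show ?thesis
    using S conjugate_pair_optimal[OF cp] by blast
qed

end
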